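(* Let $\underline Z_n=\boldsymbol X_n\underline\theta_0+\underline e_n$ with $\underline\theta_0\in\mathbb R^r$, where the fixed design matrices $\boldsymbol X_n\in\mathbb R^{n\times r}$ satisfy Assumption D and $\{e_t\}$ is a stationary mean zero Gaussian time series with spectral density $f_0$ satisfying Assumption F. Let $0<\tau_0<\min_\omega f_0(\omega)\le\max_\omega f_0(\omega)<\tau_1<\infty$, let the prior be $P(d\underline\theta)P_{\tau_0,\tau_1}(df)$ as in the context, satisfying Assumptions P, G and K, and let $P^n_{W;\tau_0,\tau_1}(\cdot|\underline Z_n)$ be the pseudo-posterior based on Whittle's likelihood. Let $\mathcal H_n=\{f\in\mathcal C_{\tau_0,\tau_1}:\|f-f_0\|_\infty\le1/\log n\}$. Then for every sequence $(M_n)$ of positive numbers with $M_n\to\infty$, $$P^n_{W;\tau_0,\tau_1}\Big(\{\underline\theta\in\mathbb R^r:\|\boldsymbol X_n(\underline\theta-\underline\theta_0)\|\ge M_n\}\times\mathcal H_n\,\Big|\,\underline Z_n\Big)\to0$$ in $P^n_{W;0}$-probability as $n\to\infty$, where $P^n_{W;0}=P^n_W(\cdot|\underline\theta_0,f_0)$.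
   Context: Notation. $r$ is fixed. $\|\cdot\|$ is the Euclidean norm. $\lambda_j=2\pi j/n$ are the Fourier frequencies, $N=\lfloor (n-1)/2\rfloor$. The orthogonal matrix $\boldsymbol F_n\in\mathbb R^{n\times n}$ has rows $\mathbf e_0,\mathbf c_1,\mathbf s_1,\dots,\mathbf c_N,\mathbf s_N$ (and additionally $\mathbf e_{n/2}$ as last row if $n$ is even), where $\mathbf e_j=n^{-1/2}(e_j,e_j^2,\dots,e_j^n)^T$ with $e_j=\exp(-2\pi i j/n)$, $\mathbf c_j=\sqrt2\,\mathrm{Re}\,\mathbf e_j$, $\mathbf s_j=\sqrt2\,\mathrm{Im}\,\mathbf e_j$. Put $\tilde{\underline z}_n=\boldsymbol F_n\underline z_n$, $\tilde{\boldsymbol X}_n=\boldsymbol F_n\boldsymbol X_n$. For a spectral density $f$, $\boldsymbol D_n=\boldsymbol D_n(f)=2\pi\,\mathrm{diag}(f(0),f(\lambda_1),f(\lambda_1),\dots,f(\lambda_N),f(\lambda_N))$ for $n$ odd, with an additional last diagonal entry $2\pi f(\lambda_{n/2})$ for $n$ even. Whittle's likelihood $P_W^n(\cdot|\underline\theta,f)$ is the distribution of $\underline Z_n$ with Lebesgue density $$p_W^n(\underline z_n|\underline\theta,f)=\frac1{\sqrt{(2\pi)^n|\boldsymbol D_n|}}\exp\Big(-\tfrac12(\tilde{\underline z}_n-\tilde{\boldsymbol X}_n\underline\theta)^T\boldsymbol D_n^{-1}(\tilde{\underline z}_n-\tilde{\boldsymbol X}_n\underline\theta)\Big).$$ Assumption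 D: $\boldsymbol X_n$ has full rank for $n$ sufficiently large and $0<\liminf_n\frac1n\lambda_{\min}(\boldsymbol X_n^T\boldsymbol X_n)\le\limsup_n\frac1n\lambda_{\max}(\boldsymbol X_n^T\boldsymbol X_n)<\infty$. Assumption F: $f_0$ is uniformly bounded and uniformly bounded away from $0$, and the autocovariance function $\gamma_0(h)=\int_0^{2\pi}f_0(\omega)e^{ih\omega}d\omega$ satisfies $\sum_{h\ge0}|\gamma_0(h)|h^a<\infty$ for some $1<a\le2$. Prior. $\underline\theta$ and $f$ are a priori independent. For $0<\tau_0<\tau_1<\infty$ let $\mathcal C_{\tau_0,\tau_1}=\{f\in\mathcal C^1([0,\pi]):\|f^{-1}\|_\infty\le\tau_0^{-1},\ \|f\|_L\le\tau_1\}$, with $\|f\|_L=\|f\|_\infty+\sup_{\omega_1\ne\omega_2}|f(\omega_1)-f(\omega_2)|/|\omega_1-\omega_2|$. The Bernstein-Gamma prior $P(df)$ is the law of $f(\omega)=\sum_{j=1}^k\Phi(I_{j,k})\,b(\omega/\pi|j,k-j+1)$, $0\le\omega\le\pi$, where $I_{j,k}=((j-1)\pi/k,j\pi/k]$, $b(\cdot|j,l)$ is the $\mathrm{Beta}(j,l)$ density on $[0,1]$, $k\in\mathbb N$ has probability mass function $p(k)$, and independently $\Phi\sim\mathrm{GP}(\alpha,\beta)$ is a Gamma process on $[0,\pi]$ with $\alpha,\beta:[0,\pi]\to(0,\infty)$ (the completely random measure with Lévy measure $\alpha(x)s^{-1}e^{-\beta(x)s}\,ds\,dx$ on $[0,\pi]\times(0,\infty)$).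 $P_{\tau_0,\tau_1}(F)=P(F\cap\mathcal C_{\tau_0,\tau_1})/P(\mathcal C_{\tau_0,\tau_1})$. Assumption P: the prior $P(d\underline\theta)$ satisfies $E\|\underline\theta\|^\nu<\infty$ for some $\nu>0$ and has a Lebesgue density $g$ on $\mathbb R^r$ with $g\le C$ for some $C>0$, which is continuous and strictly positive in an open neighbourhood of $\underline\theta_0$. Assumption G: there are positive constants $g_0,g_1$ with $g_0\le\alpha(x),\beta(x)\le g_1$ for all $x\in[0,\pi]$ outside a Lebesgue null set. Assumption K: there are positive constants $A_1,A_2,\kappa_1,\kappa_2$ with $A_1\exp(-\kappa_1j\log j)\le p(j)\le A_2\exp(-\kappa_2j)$ for all $j\in\mathbb N$. The pseudo-posterior $P^n_{W;\tau_0,\tau_1}(d\underline\theta,df|\underline Z_n)$ is proportional to $p_W^n(\underline Z_n|\underline\theta,f)P(d\underline\theta)P_{\tau_0,\tau_1}(df)$. *)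

theory Defs
  imports "HOL-Probability.Probability"
begin

section \<open>Linear model\<close>

text \<open>
  The parameter space is \<open>real ^ 'r\<close>. Objects of length \<open>n\<close>, with \<open>n\<close> varying, are functions
  on an explicit index set: the time index \<open>t\<close> runs over \<open>{1..n}\<close>, the index \<open>i\<close> of the rows of
  the Fourier matrix over \<open>{..<n}\<close>. A design is a family \<open>X\<close> where \<open>X n t\<close> is the \<open>t\<close>-th row
  of the \<open>n \<times> r\<close> matrix; thus \<open>X n t \<bullet> \<theta>\<close> is the \<open>t\<close>-th entry of its product with \<open>\<theta>\<close>.
\<close>

type_synonym 'r design = "nat \<Rightarrow> nat \<Rightarrow> real ^ 'r"

definition gram :: "'r::finite design \<Rightarrow> nat \<Rightarrow> real ^ 'r ^ 'r" where
  "gram X n = (\<chi> a b. \<Sum>t=1..n. X n t $ a * X n t $ b)"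

definition eigenvalues :: "real ^ 'r ^ 'r \<Rightarrow> real set" where
  "eigenvalues A = {c. \<exists>v. v \<noteq> 0 \<and> A *v v = c *\<^sub>R v}"

text \<open>These are used for symmetric matrices only, whose set of eigenvalues is finite and nonempty.\<close>

definition eig_min :: "real ^ 'r::finite ^ 'r \<Rightarrow> real" where
  "eig_min A = Min (eigenvalues A)"

definition eig_max :: "real ^ 'r::finite ^ 'r \<Rightarrow> real" where
  "eig_max A = Max (eigenvalues A)"

text \<open>Full rank for large \<open>n\<close> is rank \<open>r\<close>, expressed here as row rank.\<close>

definition regular_design :: "'r::finite design \<Rightarrow> bool" where
  "regular_design X \<longleftrightarrow>
     (\<forall>\<^sub>F n in sequentially. dim (X n ` {1..n}) = CARD('r)) \<and>
     0 < liminf (\<lambda>n. ereal (eig_min (gram X n) / real n)) \<and>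
     liminf (\<lambda>n. ereal (eig_min (gram X n) / real n))
       \<le> limsup (\<lambda>n. ereal (eig_max (gram X n) / real n)) \<and>
     limsup (\<lambda>n. ereal (eig_max (gram X n) / real n)) < \<infinity>"


section \<open>Stationary Gaussian time series\<close>

definition autocov :: "(real \<Rightarrow> real) \<Rightarrow> int \<Rightarrow> complex" where
  "autocov f h = set_lebesgue_integral lborel {0..2*pi}
     (\<lambda>\<omega>. complex_of_real (f \<omega>) * exp (\<i> * of_int h * complex_of_real \<omega>))"

text \<open>Normal distributions with variance zero are allowed.\<close>

definition gaussian_rv :: "'w measure \<Rightarrow> ('w \<Rightarrow> real) \<Rightarrow> bool" where
  "gaussian_rv M Y \<longleftrightarrow> Y \<in> borel_measurable M \<and>
     ((\<exists>\<mu>. AE w in M. Y w = \<mu>) \<or>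
      (\<exists>\<mu> \<sigma>. 0 < \<sigma> \<and> distributed M lborel Y (normal_density \<mu> \<sigma>)))"

definition gaussian_series_with_spectral_density ::
  "'w measure \<Rightarrow> (int \<Rightarrow> 'w \<Rightarrow> real) \<Rightarrow> (real \<Rightarrow> real) \<Rightarrow> bool" where
  "gaussian_series_with_spectral_density M e f \<longleftrightarrow>
     prob_space M \<and>
     (\<forall>J c. finite J \<longrightarrow> gaussian_rv M (\<lambda>w. \<Sum>t\<in>J. c t * e t w)) \<and>
     (\<forall>t. integrable M (\<lambda>w. (e t w)\<^sup>2) \<and> (\<integral>w. e t w \<partial>M) = 0) \<and>
     set_integrable lborel {0..2*pi} f \<and> (\<forall>\<omega>\<in>{0..2*pi}. 0 \<le> f \<omega>) \<and>
     (\<forall>t h. complex_of_real (\<integral>w. e t w * e (t + h) w \<partial>M) = autocov f h)"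

definition regular_spectral_density :: "(real \<Rightarrow> real) \<Rightarrow> bool" where
  "regular_spectral_density f \<longleftrightarrow>
     (\<exists>c C. 0 < c \<and> (\<forall>\<omega>\<in>{0..2*pi}. c \<le> f \<omega> \<and> f \<omega> \<le> C)) \<and>
     (\<exists>a. 1 < a \<and> a \<le> 2 \<and>
        summable (\<lambda>h::nat. cmod (autocov f (int h)) * real h powr a))"


section \<open>Whittle's likelihood\<close>

definition fourier_vec :: "nat \<Rightarrow> nat \<Rightarrow> nat \<Rightarrow> complex" where
  "fourier_vec n j t = exp (- 2 * complex_of_real pi * \<i> * of_nat j / of_nat n) ^ t
     / complex_of_real (sqrt (real n))"

text \<open>
  Row \<open>0\<close> is the constant vector, rows \<open>2 * j - 1\<close> and \<open>2 * j\<close> are the cosine and sine vectors of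
  frequency \<open>j\<close>, and for even \<open>n\<close> the last row \<open>n - 1\<close> is the alternating vector. The first and
  the last of these are real, so that taking the real part only changes their type.
\<close>

definition fourier_mat :: "nat \<Rightarrow> nat \<Rightarrow> nat \<Rightarrow> real" where
  "fourier_mat n i t =
     (if i = 0 then Re (fourier_vec n 0 t)
      else if even n \<and> i = n - 1 then Re (fourier_vec n (n div 2) t)
      else if odd i then sqrt 2 * Re (fourier_vec n ((i + 1) div 2) t)
      else sqrt 2 * Im (fourier_vec n (i div 2) t))"

text \<open>
  The \<open>i\<close>-th entry of the diagonal matrix: row \<open>i\<close> of the Fourier matrix belongs to
  the frequency with index \<open>(i + 1) div 2\<close>.
\<close>

definition whittle_diag :: "nat \<Rightarrow> (real \<Rightarrow> real) \<Rightarrow> nat \<Rightarrow> real" where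
  "whittle_diag n f i = 2 * pi * f (2 * pi * real ((i + 1) div 2) / real n)"

definition fourier_data :: "nat \<Rightarrow> (nat \<Rightarrow> real) \<Rightarrow> nat \<Rightarrow> real" where
  "fourier_data n z i = (\<Sum>t=1..n. fourier_mat n i t * z t)"

definition fourier_design :: "'r::finite design \<Rightarrow> 'r design" where
  "fourier_design X n i = (\<Sum>t=1..n. fourier_mat n i t *\<^sub>R X n t)"

text \<open>The determinant and the quadratic form are those of a diagonal matrix.\<close>

definition whittle_density ::
  "'r::finite design \<Rightarrow> nat \<Rightarrow> real ^ 'r \<Rightarrow> (real \<Rightarrow> real) \<Rightarrow> (nat \<Rightarrow> real) \<Rightarrow> real" where
  "whittle_density X n \<theta> f z =
     1 / sqrt ((2 * pi) ^ n * (\<Prod>i<n. whittle_diag n f i)) *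
     exp (- (1 / 2) * (\<Sum>i<n. (fourier_data n z i - fourier_design X n i \<bullet> \<theta>)\<^sup>2
                               / whittle_diag n f i))"

definition whittle_measure ::
  "'r::finite design \<Rightarrow> nat \<Rightarrow> real ^ 'r \<Rightarrow> (real \<Rightarrow> real) \<Rightarrow> (nat \<Rightarrow> real) measure" where
  "whittle_measure X n \<theta> f =
     density (\<Pi>\<^sub>M t\<in>{1..n}. lborel) (\<lambda>z. ennreal (whittle_density X n \<theta> f z))"


section \<open>Function spaces\<close>

text \<open>
  Continuous functions on \<open>{0..pi}\<close>, extended by \<open>undefined\<close>, with the \<open>\<sigma>\<close>-algebra
  generated by the point evaluations. It is the Borel \<open>\<sigma>\<close>-algebra of the supremum norm.
\<close>

definition cont_space :: "(real \<Rightarrow> real) measure" where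
  "cont_space = restrict_space (\<Pi>\<^sub>M x\<in>{0..pi}. borel) {f. continuous_on {0..pi} f}"

definition sup_norm :: "(real \<Rightarrow> real) \<Rightarrow> real" where
  "sup_norm f = (SUP x\<in>{0..pi}. \<bar>f x\<bar>)"

definition lip_norm :: "(real \<Rightarrow> real) \<Rightarrow> real" where
  "lip_norm f = sup_norm f +
     (SUP (x, y)\<in>{(x, y). x \<in> {0..pi} \<and> y \<in> {0..pi} \<and> x \<noteq> y}. \<bar>f x - f y\<bar> / \<bar>x - y\<bar>)"

definition C1_on_interval :: "(real \<Rightarrow> real) \<Rightarrow> bool" where
  "C1_on_interval f \<longleftrightarrow>
     (\<exists>f'. continuous_on {0..pi} f' \<and>
        (\<forall>x\<in>{0..pi}. (f has_real_derivative f' x) (at x within {0..pi})))"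

text \<open>
  Spectral densities bounded away from zero. Positivity is required explicitly, as otherwise
  \<open>inverse 0 = 0\<close> would let the zero function satisfy the bound on the reciprocal.
\<close>

definition spectral_class :: "real \<Rightarrow> real \<Rightarrow> (real \<Rightarrow> real) set" where
  "spectral_class \<tau>0 \<tau>1 = {f \<in> space cont_space. C1_on_interval f \<and>
     (\<forall>x\<in>{0..pi}. 0 < f x) \<and> sup_norm (\<lambda>x. inverse (f x)) \<le> inverse \<tau>0 \<and> lip_norm f \<le> \<tau>1}"


section \<open>The Bernstein-Gamma prior\<close>

text \<open>Finite random measures on \<open>{0..pi}\<close> with independent values on disjoint sets.\<close>

definition completely_random_measure :: "'o measure \<Rightarrow> ('o \<Rightarrow> real measure) \<Rightarrow> bool" where
  "completely_random_measure M \<Phi> \<longleftrightarrow>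
     prob_space M \<and>
     (\<forall>w\<in>space M. finite_measure (\<Phi> w) \<and> sets (\<Phi> w) = sets (restrict_space borel {0..pi})) \<and>
     (\<forall>A\<in>sets (restrict_space borel {0..pi}). (\<lambda>w. measure (\<Phi> w) A) \<in> borel_measurable M) \<and>
     (\<forall>(A :: nat \<Rightarrow> real set) m.
        (\<forall>i<m. A i \<in> sets (restrict_space borel {0..pi})) \<and> disjoint_family_on A {..<m} \<longrightarrow>
        prob_space.indep_vars M (\<lambda>_. borel) (\<lambda>i w. measure (\<Phi> w) (A i)) {..<m})"

definition gamma_levy_measure ::
  "(real \<Rightarrow> real) \<Rightarrow> (real \<Rightarrow> real) \<Rightarrow> (real \<times> real) measure" where
  "gamma_levy_measure \<alpha> \<beta> =
     density (lebesgue_on {0..pi} \<Otimes>\<^sub>M restrict_space lborel {0<..})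
       (\<lambda>(x, s). ennreal (\<alpha> x * inverse s * exp (- \<beta> x * s)))"

text \<open>
  The last condition is the Levy-Khinchine formula for the Laplace transform,
  without fixed atoms and without deterministic part.
\<close>

definition gamma_process ::
  "'o measure \<Rightarrow> ('o \<Rightarrow> real measure) \<Rightarrow> (real \<Rightarrow> real) \<Rightarrow> (real \<Rightarrow> real) \<Rightarrow> bool" where
  "gamma_process M \<Phi> \<alpha> \<beta> \<longleftrightarrow>
     completely_random_measure M \<Phi> \<and>
     \<alpha> \<in> borel_measurable (lebesgue_on {0..pi}) \<and> \<beta> \<in> borel_measurable (lebesgue_on {0..pi}) \<and>
     (\<forall>x\<in>{0..pi}. 0 < \<alpha> x \<and> 0 < \<beta> x) \<and>
     (\<forall>A\<in>sets (restrict_space borel {0..pi}). \<forall>u\<ge>0.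
        ennreal (- ln (\<integral>w. exp (- u * measure (\<Phi> w) A) \<partial>M)) =
        (\<integral>\<^sup>+ (x, s). indicator A x * ennreal (1 - exp (- u * s)) \<partial>gamma_levy_measure \<alpha> \<beta>))"

text \<open>
  Powers with natural exponents, rather than \<open>powr\<close>, give the correct values at \<open>0\<close> and \<open>1\<close>.
\<close>

definition beta_density :: "nat \<Rightarrow> nat \<Rightarrow> real \<Rightarrow> real" where
  "beta_density j l x = x ^ (j - 1) * (1 - x) ^ (l - 1) / Beta (real j) (real l)"

definition bernstein_mixture :: "real measure \<Rightarrow> nat \<Rightarrow> real \<Rightarrow> real" where
  "bernstein_mixture \<phi> k = (\<lambda>\<omega>\<in>{0..pi}.
     \<Sum>j=1..k. measure \<phi> {(real j - 1) * pi / real k <.. real j * pi / real k} *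
       beta_density j (k - j + 1) (\<omega> / pi))"

definition bernstein_gamma_prior ::
  "'o measure \<Rightarrow> ('o \<Rightarrow> nat) \<Rightarrow> ('o \<Rightarrow> real measure) \<Rightarrow> (real \<Rightarrow> real) measure" where
  "bernstein_gamma_prior M K \<Phi> = distr M cont_space (\<lambda>w. bernstein_mixture (\<Phi> w) (K w))"

text \<open>
  Independence of \<open>K\<close> and \<open>\<Phi>\<close> is stated for the generated \<open>\<sigma>\<close>-algebras, as \<open>indep_var\<close>
  only applies to variables of the same type.
\<close>

definition bernstein_gamma_model ::
  "'o measure \<Rightarrow> ('o \<Rightarrow> nat) \<Rightarrow> ('o \<Rightarrow> real measure) \<Rightarrow> nat pmf \<Rightarrow>
   (real \<Rightarrow> real) \<Rightarrow> (real \<Rightarrow> real) \<Rightarrow> bool" where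
  "bernstein_gamma_model M K \<Phi> p \<alpha> \<beta> \<longleftrightarrow>
     gamma_process M \<Phi> \<alpha> \<beta> \<and>
     K \<in> measurable M (count_space UNIV) \<and>
     distr M (count_space UNIV) K = measure_pmf p \<and> 0 \<notin> set_pmf p \<and>
     prob_space.indep_set M
       (sets (vimage_algebra (space M) K (count_space UNIV)))
       (sets (vimage_algebra (space M)
          (\<lambda>w. \<lambda>A\<in>sets (restrict_space borel {0..pi}). measure (\<Phi> w) A)
          (\<Pi>\<^sub>M A\<in>sets (restrict_space borel {0..pi}). borel)))"


section \<open>Pseudo-posterior\<close>

definition whittle_posterior ::
  "'r::finite design \<Rightarrow> (real ^ 'r) measure \<Rightarrow> (real \<Rightarrow> real) measure \<Rightarrow> nat \<Rightarrow> (nat \<Rightarrow> real) \<Rightarrow>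
   ((real ^ 'r) \<times> (real \<Rightarrow> real)) measure" where
  "whittle_posterior X P\<theta> Pf n z =
     density (P\<theta> \<Otimes>\<^sub>M Pf)
       (\<lambda>(\<theta>, f). ennreal (whittle_density X n \<theta> f z) /
          (\<integral>\<^sup>+ (\<theta>', f'). ennreal (whittle_density X n \<theta>' f' z) \<partial>(P\<theta> \<Otimes>\<^sub>M Pf)))"

end

(*
For a fixed spectral density f the Whittle likelihood is Gaussian in theta. With h = theta - theta0,
its logarithm is, up to a constant, a linear form in h minus a quadratic form that is comparable to
|X h|^2, since f is bounded away from 0 and infinity. If the linear form is at most K |X h|, then,
relative to the whole integral over theta, the integral over |X h| >= M is at most a constant times
exp (- c M^2), with both constants independent of f; integrating over f preserves this ratio.
So it remains to bound the linear form in probability, uniformly over f. Its dependence on f is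
through the Lipschitz weights 1 / f at the Fourier frequencies: summation by parts bounds it by
averages of partial sums that do not involve f, whose first moments are bounded under the Whittle
measure because the Fourier transform turns it into a product of normal distributions.
*)
theory Submission
  imports Defs
begin

section \<open>The Fourier matrix\<close>

text \<open>A probability bound for each fixed \<open>f\<close> would not do: the posterior mixes
  over an uncountable class, so one exceptional event has to serve all \<open>f\<close> at once.
  This is possible because adjacent rows of the Fourier matrix belong to frequencies at most
  \<open>2 * pi / n\<close> apart, so that the weights have a total variation bounded independently
  of \<open>n\<close> and \<open>f\<close>.

  The natural scale of \<open>h\<close> is \<open>1 / sqrt n\<close>. The partial sums deviate by
  order \<open>sqrt n\<close>, and \<open>regular_design\<close> makes \<open>|X h|\<close>
  comparable to \<open>sqrt n * |h|\<close>; hence the linear form is of the order of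
  \<open>|X h|\<close>. The bounds for the two integrals over theta both carry the factor
  \<open>n powr (- r / 2)\<close>, which cancels in the ratio.

  Measurability is proved for the likelihood and for the variable dominating the score, not for
  \<open>spectral_class\<close> or the posterior event. The estimates are therefore one-sided and
  valid for arbitrary sets, and the case where the conditioning class has \<open>emeasure\<close>
  zero is settled by the conventions of \<open>ennreal\<close>.\<close>

lemma sum_cos_roots_of_unity:
  fixes k :: int
  assumes "0 < n"
  shows "(\<Sum>j<n. cos (2 * pi * of_int k * real j / real n)) = (if int n dvd k then real n else 0)"
proof -
  define x where "x = cis (2 * pi * of_int k / real n)"
  have pow: "x ^ j = cis (2 * pi * of_int k * real j / real n)" for j
    unfolding x_def Complex.DeMoivre by (simp add: field_simps)
  have "(\<Sum>j<n. cos (2 * pi * of_int k * real j / real n)) = Re (\<Sum>j<n. x ^ j)"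
    by (simp add: pow)
  also have "\<dots> = (if int n dvd k then real n else 0)"
  proof (cases "int n dvd k")
    case True
    then obtain m where m: "k = int n * m" by blast
    have "x = cis (2 * pi * of_int m)"
      unfolding x_def m using assms by (simp add: mult.assoc del: cis_multiple_2pi)
    then have "x = 1" by (simp only: cis_multiple_2pi Ints_of_int)
    then show ?thesis using True by simp
  next
    case False
    have "x \<noteq> 1"
    proof
      assume "x = 1"
      then have "cos (2 * pi * of_int k / real n) = 1"
        unfolding x_def by (metis cis.simps(1) one_complex.simps(1))
      then obtain m :: int where "2 * pi * of_int k / real n = of_int m * 2 * pi"
        unfolding cos_one_2pi_int by auto
      then have "real_of_int k = real_of_int (m * int n)"
        using assms by (simp add: field_simps)
      then have "k = m * int n" by linarith
      then show False using False by simp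
    qed
    moreover have "x ^ n = 1"
      using assms by (simp add: pow cis_multiple_2pi)
    ultimately have "(\<Sum>j<n. x ^ j) = 0"
      by (simp add: geometric_sum)
    then show ?thesis using False by simp
  qed
  finally show ?thesis .
qed

lemma Re_fourier_vec: "Re (fourier_vec n j t) = cos (2 * pi * real j * real t / real n) / sqrt (real n)"
  and Im_fourier_vec: "Im (fourier_vec n j t) = - sin (2 * pi * real j * real t / real n) / sqrt (real n)"
proof -
  have "exp (- 2 * complex_of_real pi * \<i> * of_nat j / of_nat n) = cis (- (2 * pi * real j / real n))"
    unfolding cis_conv_exp by (simp add: field_simps)
  then have "fourier_vec n j t = cis (- (2 * pi * real j * real t / real n)) / complex_of_real (sqrt (real n))"
    unfolding fourier_vec_def by (simp add: Complex.DeMoivre mult_ac)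
  then show "Re (fourier_vec n j t) = cos (2 * pi * real j * real t / real n) / sqrt (real n)"
    and "Im (fourier_vec n j t) = - sin (2 * pi * real j * real t / real n) / sqrt (real n)"
    by (simp_all add: Re_divide_of_real Im_divide_of_real)
qed

lemma sum_lessThan_pairs:
  fixes h :: "nat \<Rightarrow> 'a::comm_monoid_add"
  shows "(\<Sum>i<2 * N + 1. h i) = h 0 + (\<Sum>j<N. h (2 * j + 1) + h (2 * j + 2))"
  by (induction N) (simp_all add: ac_simps)

lemma fourier_mat_columns_orthonormal:
  assumes "0 < n" "t \<in> {1..n}" "s \<in> {1..n}"
  shows "(\<Sum>i<n. fourier_mat n i t * fourier_mat n i s) = (if t = s then 1 else 0)"
proof -
  define k where "k = int t - int s"
  define c where "c j = cos (2 * pi * of_int k * real j / real n) / real n" for j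
  define h where "h i = fourier_mat n i t * fourier_mat n i s" for i
  define N where "N = (n - 1) div 2"
  have h0: "h 0 = c 0"
    unfolding h_def fourier_mat_def c_def by (simp add: Re_fourier_vec)
  \<comment> \<open>Row \<open>2 * j + 1\<close> is the cosine and row \<open>2 * j + 2\<close> the
    sine of frequency \<open>j + 1\<close>; their products combine to the cosine of a difference,
    which depends on \<open>t - s\<close> only.\<close>
  have pair: "h (2 * j + 1) + h (2 * j + 2) = 2 * c (j + 1)" if "j < N" for j
  proof -
    define a where "a = 2 * pi * real (j + 1) * real t / real n"
    define b where "b = 2 * pi * real (j + 1) * real s / real n"
    have odd: "fourier_mat n (2 * j + 1) u = sqrt 2 * (cos (2 * pi * real (j + 1) * real u / real n) / sqrt (real n))"
      for u
    proof -
      have "\<not> (even n \<and> 2 * j + 1 = n - 1)" using that unfolding N_def by presburger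
      moreover have "(2 * j + 1 + 1) div 2 = j + 1" by simp
      ultimately show ?thesis
        unfolding fourier_mat_def Re_fourier_vec[symmetric] by auto
    qed
    have even: "fourier_mat n (2 * j + 2) u = sqrt 2 * (- sin (2 * pi * real (j + 1) * real u / real n) / sqrt (real n))"
      for u
    proof -
      have "\<not> (even n \<and> 2 * j + 2 = n - 1)" using that unfolding N_def by presburger
      moreover have "(2 * j + 2) div 2 = j + 1" by simp
      ultimately show ?thesis
        unfolding fourier_mat_def Im_fourier_vec[symmetric] by auto
    qed
    have "h (2 * j + 1) + h (2 * j + 2) = 2 * (cos a * cos b + sin a * sin b) / real n"
      unfolding h_def odd even a_def[symmetric] b_def[symmetric] using assms(1)
      by (simp add: field_simps)
    also have "\<dots> = 2 * cos (a - b) / real n" by (simp add: cos_diff)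
    also have "a - b = 2 * pi * of_int k * real (j + 1) / real n"
      unfolding a_def b_def k_def by (simp add: field_simps diff_divide_distrib)
    finally show ?thesis unfolding c_def by simp
  qed
  \<comment> \<open>The alternating row has no sine partner, but the sine of \<open>pi * t\<close>
    vanishes, so its cosines alone satisfy the addition formula. Frequency \<open>n div 2\<close> is
    its own mirror image, which is why this row lacks the factor \<open>sqrt 2\<close>.\<close>
  have last: "h (n - 1) = c (n div 2)" if "even n"
  proof -
    have n2: "n - 1 \<noteq> 0" using that assms(1) by presburger
    have arg: "2 * pi * real (n div 2) * x / real n = pi * x" for x
      using that assms(1) by (simp add: real_of_nat_div)
    have "h (n - 1) = cos (pi * real t) * cos (pi * real s) / real n"
      unfolding h_def fourier_mat_def using that n2 assms(1) by (simp add: Re_fourier_vec arg)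
    also have "\<dots> = cos (pi * real t - pi * real s) / real n"
      by (simp add: cos_diff sin_npi2)
    also have "pi * real t - pi * real s = 2 * pi * of_int k * real (n div 2) / real n"
      using arg[of "of_int k"] unfolding k_def by (simp add: algebra_simps)
    finally show ?thesis unfolding c_def .
  qed
  have sum_h: "(\<Sum>i<n. h i) = (\<Sum>i<n. c ((i + 1) div 2))"
  proof -
    have main: "(\<Sum>i<2 * N + 1. h i) = (\<Sum>i<2 * N + 1. c ((i + 1) div 2))"
      unfolding sum_lessThan_pairs using h0 pair by simp
    show ?thesis
    proof (cases "even n")
      case True
      then have n: "n = Suc (2 * N + 1)" using assms(1) unfolding N_def by presburger
      have "h (2 * N + 1) = c ((2 * N + 1 + 1) div 2)" using last True n by simp
      then show ?thesis using main by (subst (1 2) n) simp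
    next
      case False
      then have n: "n = 2 * N + 1" using assms(1) unfolding N_def by presburger
      show ?thesis using main by (subst (1 2) n)
    qed
  qed
  have c_sym: "c (n - j) = c j" if "j \<le> n" for j
  proof -
    have "2 * pi * of_int k * real (n - j) / real n = of_int k * (2 * pi) - 2 * pi * of_int k * real j / real n"
      using that assms(1) by (simp add: of_nat_diff field_simps)
    moreover have "cos (of_int k * (2 * pi)) = 1" "sin (of_int k * (2 * pi)) = 0"
      using cos_int_2pin[of k] sin_int_2pin[of k] by (simp_all add: mult_ac)
    ultimately show ?thesis
      unfolding c_def by (simp only: cos_diff) simp
  qed
  \<comment> \<open>A frequency strictly between \<open>0\<close> and \<open>n / 2\<close> occurs
    twice on the left. Its second occurrence, at an even row \<open>i\<close>, is sent to the mirror
    frequency \<open>n - i div 2\<close>, where \<open>c\<close> has the same value, so that a full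
    period results.\<close>
  have "(\<Sum>i<n. c ((i + 1) div 2)) = (\<Sum>j<n. c j)"
  proof (rule sum.reindex_bij_witness[where
      j = "\<lambda>i. if odd i \<or> i = 0 then (i + 1) div 2 else n - i div 2" and
      i = "\<lambda>j. if j = 0 then 0 else if 2 * j \<le> n then 2 * j - 1 else 2 * (n - j)"])
    fix i assume "i \<in> {..<n}"
    then have i: "i < n" by simp
    show "(if (if odd i \<or> i = 0 then (i + 1) div 2 else n - i div 2) = 0 then 0
          else if 2 * (if odd i \<or> i = 0 then (i + 1) div 2 else n - i div 2) \<le> n
               then 2 * (if odd i \<or> i = 0 then (i + 1) div 2 else n - i div 2) - 1
               else 2 * (n - (if odd i \<or> i = 0 then (i + 1) div 2 else n - i div 2))) = i"
      using i by (auto elim!: oddE evenE)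
    show "(if odd i \<or> i = 0 then (i + 1) div 2 else n - i div 2) \<in> {..<n}"
      using i by (auto elim!: oddE evenE)
    show "c (if odd i \<or> i = 0 then (i + 1) div 2 else n - i div 2) = c ((i + 1) div 2)"
      using i c_sym[of "i div 2"] by (auto)
  next
    fix j assume "j \<in> {..<n}"
    then have j: "j < n" by simp
    show "(if odd (if j = 0 then 0 else if 2 * j \<le> n then 2 * j - 1 else 2 * (n - j)) \<or>
            (if j = 0 then 0 else if 2 * j \<le> n then 2 * j - 1 else 2 * (n - j)) = 0
         then ((if j = 0 then 0 else if 2 * j \<le> n then 2 * j - 1 else 2 * (n - j)) + 1) div 2
         else n - (if j = 0 then 0 else if 2 * j \<le> n then 2 * j - 1 else 2 * (n - j)) div 2) = j"
      using j by auto
    show "(if j = 0 then 0 else if 2 * j \<le> n then 2 * j - 1 else 2 * (n - j)) \<in> {..<n}"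
      using j by auto
  qed
  also have "\<dots> = (\<Sum>j<n. cos (2 * pi * of_int k * real j / real n)) / real n"
    unfolding c_def by (simp add: sum_divide_distrib)
  also have "\<dots> = (if int n dvd k then 1 else 0)"
    using assms(1) by (simp add: sum_cos_roots_of_unity)
  also have "int n dvd k \<longleftrightarrow> t = s"
  proof
    assume "int n dvd k"
    moreover have "\<bar>k\<bar> < int n" using assms unfolding k_def by auto
    ultimately have "k = 0" using zdvd_not_zless[of "\<bar>k\<bar>" "int n"] by force
    then show "t = s" unfolding k_def by simp
  qed (simp add: k_def)
  finally show ?thesis using sum_h unfolding h_def by simp
qed

text \<open>
  For a square matrix with orthonormal columns, let \<open>P\<close> be the Gram matrix of the rows. Then
  \<open>P\<close> and \<open>P\<^sup>2\<close> both have trace \<open>n\<close>, so that \<open>I - P\<close> has Frobenius norm \<open>0\<close>.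
\<close>

lemma rows_orthonormal_if_columns_orthonormal:
  fixes A :: "nat \<Rightarrow> nat \<Rightarrow> real"
  assumes "finite I" "finite T" "card I = card T"
    and cols: "\<And>t s. t \<in> T \<Longrightarrow> s \<in> T \<Longrightarrow> (\<Sum>i\<in>I. A i t * A i s) = (if t = s then 1 else 0)"
    and "i \<in> I" "j \<in> I"
  shows "(\<Sum>t\<in>T. A i t * A j t) = (if i = j then 1 else 0)"
proof -
  define P where "P i j = (\<Sum>t\<in>T. A i t * A j t)" for i j
  define \<delta> :: "nat \<Rightarrow> nat \<Rightarrow> real" where "\<delta> i j = (if i = j then 1 else 0)" for i j
  have delta: "(\<Sum>i\<in>I. \<Sum>j\<in>I. (\<delta> i j)\<^sup>2) = real (card T)"
  proof -
    have "(\<Sum>i\<in>I. \<Sum>j\<in>I. (\<delta> i j)\<^sup>2) = (\<Sum>i\<in>I. \<Sum>j\<in>I. if i = j then 1 else 0)"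
      unfolding \<delta>_def by (intro sum.cong) auto
    then show ?thesis using assms(1,3) by (simp add: sum.delta)
  qed
  have tr: "(\<Sum>i\<in>I. P i i) = real (card T)"
  proof -
    have "(\<Sum>i\<in>I. P i i) = (\<Sum>t\<in>T. \<Sum>i\<in>I. A i t * A i t)"
      unfolding P_def by (rule sum.swap)
    also have "\<dots> = (\<Sum>t\<in>T. 1)" using cols by (intro sum.cong) auto
    finally show ?thesis by simp
  qed
  have cross: "(\<Sum>i\<in>I. \<Sum>j\<in>I. \<delta> i j * P i j) = (\<Sum>i\<in>I. P i i)"
  proof (rule sum.cong[OF refl])
    fix i assume "i \<in> I"
    have "(\<Sum>j\<in>I. \<delta> i j * P i j) = (\<Sum>j\<in>I. if i = j then P i j else 0)"
      unfolding \<delta>_def by (intro sum.cong) auto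
    then show "(\<Sum>j\<in>I. \<delta> i j * P i j) = P i i"
      using assms(1) \<open>i \<in> I\<close> by simp
  qed
  have sq: "(\<Sum>i\<in>I. \<Sum>j\<in>I. (P i j)\<^sup>2) = real (card T)"
  proof -
    have "(P i j)\<^sup>2 = (\<Sum>t\<in>T. \<Sum>s\<in>T. (A i t * A i s) * (A j t * A j s))" for i j
      unfolding P_def power2_eq_square sum_product by (simp add: mult_ac)
    then have "(\<Sum>i\<in>I. \<Sum>j\<in>I. (P i j)\<^sup>2)
        = (\<Sum>i\<in>I. \<Sum>j\<in>I. \<Sum>t\<in>T. \<Sum>s\<in>T. (A i t * A i s) * (A j t * A j s))"
      by simp
    also have "\<dots> = (\<Sum>i\<in>I. \<Sum>t\<in>T. \<Sum>j\<in>I. \<Sum>s\<in>T. (A i t * A i s) * (A j t * A j s))"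
      by (rule sum.cong[OF refl], rule sum.swap)
    also have "\<dots> = (\<Sum>t\<in>T. \<Sum>i\<in>I. \<Sum>s\<in>T. \<Sum>j\<in>I. (A i t * A i s) * (A j t * A j s))"
      by (rule trans[OF sum.swap], rule sum.cong[OF refl], rule sum.cong[OF refl], rule sum.swap)
    also have "\<dots> = (\<Sum>t\<in>T. \<Sum>s\<in>T. \<Sum>i\<in>I. \<Sum>j\<in>I. (A i t * A i s) * (A j t * A j s))"
      by (rule sum.cong[OF refl], rule sum.swap)
    also have "\<dots> = (\<Sum>t\<in>T. \<Sum>s\<in>T. (\<Sum>i\<in>I. A i t * A i s) * (\<Sum>j\<in>I. A j t * A j s))"
      by (simp add: sum_product)
    also have "\<dots> = (\<Sum>t\<in>T. \<Sum>s\<in>T. if t = s then 1 else 0)"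
      using cols by (intro sum.cong) auto
    finally show ?thesis using assms(2) by simp
  qed
  have "(\<Sum>i\<in>I. \<Sum>j\<in>I. (\<delta> i j - P i j)\<^sup>2)
      = (\<Sum>i\<in>I. \<Sum>j\<in>I. (\<delta> i j)\<^sup>2) - 2 * (\<Sum>i\<in>I. \<Sum>j\<in>I. \<delta> i j * P i j) + (\<Sum>i\<in>I. \<Sum>j\<in>I. (P i j)\<^sup>2)"
    by (simp add: power2_diff sum.distrib sum_subtractf sum_distrib_left mult_ac)
  also have "\<dots> = 0" using delta cross tr sq by simp
  finally have "\<forall>i\<in>I. \<forall>j\<in>I. (\<delta> i j - P i j)\<^sup>2 = 0"
    using assms(1) by (simp add: sum_nonneg_eq_0_iff sum_nonneg)
  then show ?thesis using assms(5,6) unfolding \<delta>_def P_def by force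
qed

section \<open>Lebesgue measure on finite products\<close>

interpretation lborel_real: product_sigma_finite "\<lambda>_. lborel :: real measure"
  by standard

lemma PiM_lborel_distr_plus:
  fixes v :: "'i \<Rightarrow> real"
  assumes I: "finite I"
  shows "distr (\<Pi>\<^sub>M i\<in>I. lborel) (\<Pi>\<^sub>M i\<in>I. lborel) (\<lambda>z. \<lambda>i\<in>I. z i + v i) = (\<Pi>\<^sub>M i\<in>I. lborel)"
    (is "?D = ?L")
proof (rule lborel_real.PiM_eqI[OF I])
  fix A :: "'i \<Rightarrow> real set" assume A: "\<And>i. i \<in> I \<Longrightarrow> A i \<in> sets lborel"
  have [measurable]: "(\<lambda>z. \<lambda>i\<in>I. z i + v i) \<in> measurable ?L ?L"
    by (rule measurable_restrict) auto
  have B: "(\<lambda>x. x + v i) -` A i \<in> sets borel" if "i \<in> I" for i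
    using measurable_sets[of "\<lambda>x. x + v i" borel borel "A i"] A[OF that] by simp
  have "emeasure ?D (Pi\<^sub>E I A) = emeasure ?L ((\<lambda>z. \<lambda>i\<in>I. z i + v i) -` Pi\<^sub>E I A \<inter> space ?L)"
    using A I by (subst emeasure_distr) (auto intro!: sets_PiM_I_finite)
  also have "(\<lambda>z. \<lambda>i\<in>I. z i + v i) -` Pi\<^sub>E I A \<inter> space ?L = Pi\<^sub>E I (\<lambda>i. (\<lambda>x. x + v i) -` A i)"
    by (auto simp: space_PiM PiE_def Pi_def)
  also have "emeasure ?L \<dots> = (\<Prod>i\<in>I. emeasure lborel ((\<lambda>x. x + v i) -` A i))"
    using B I by (subst lborel_real.emeasure_PiM) auto
  also have "\<dots> = (\<Prod>i\<in>I. emeasure lborel (A i))"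
  proof (rule prod.cong[OF refl])
    fix i assume "i \<in> I"
    have "emeasure lborel (A i) = emeasure (distr lborel borel ((+) (v i))) (A i)"
      by (simp add: lborel_distr_plus)
    also have "\<dots> = emeasure lborel ((+) (v i) -` A i)"
      using A[OF \<open>i \<in> I\<close>] by (subst emeasure_distr) auto
    also have "(+) (v i) -` A i = (\<lambda>x. x + v i) -` A i"
      by (auto simp: add.commute)
    finally show "emeasure lborel ((\<lambda>x. x + v i) -` A i) = emeasure lborel (A i)" by simp
  qed
  finally show "emeasure ?D (Pi\<^sub>E I A) = (\<Prod>i\<in>I. emeasure lborel (A i))" .
qed simp

lemma nn_integral_PiM_lborel_translate:
  fixes v :: "'i \<Rightarrow> real"
  assumes "finite I" and h: "h \<in> borel_measurable (\<Pi>\<^sub>M i\<in>I. lborel)"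
  shows "(\<integral>\<^sup>+ z. h (\<lambda>i\<in>I. z i + v i) \<partial>(\<Pi>\<^sub>M i\<in>I. lborel)) = (\<integral>\<^sup>+ z. h z \<partial>(\<Pi>\<^sub>M i\<in>I. lborel))"
proof -
  have [measurable]: "(\<lambda>z. \<lambda>i\<in>I. z i + v i) \<in> measurable (\<Pi>\<^sub>M i\<in>I. lborel) (\<Pi>\<^sub>M i\<in>I. lborel)"
    by (rule measurable_restrict) auto
  show ?thesis
    by (subst (2) PiM_lborel_distr_plus[OF assms(1), of v, symmetric])
      (use h in \<open>simp add: nn_integral_distr\<close>)
qed

section \<open>Gaussian integrals and invariance under orthogonal maps\<close>

lemma nn_integral_gaussian:
  assumes "0 < c"
  shows "(\<integral>\<^sup>+ x. ennreal (exp (- c * (x - m)\<^sup>2)) \<partial>lborel) = ennreal (sqrt (pi / c))"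
proof -
  define \<sigma> where "\<sigma> = sqrt (1 / (2 * c))"
  have \<sigma>: "0 < \<sigma>" "\<sigma>\<^sup>2 = 1 / (2 * c)" using assms unfolding \<sigma>_def by simp_all
  have "exp (- c * (x - m)\<^sup>2) = sqrt (pi / c) * normal_density m \<sigma> x" for x
    using assms unfolding normal_density_def \<sigma>(2) by (simp add: real_sqrt_divide)
  then have "(\<integral>\<^sup>+ x. ennreal (exp (- c * (x - m)\<^sup>2)) \<partial>lborel)
      = (\<integral>\<^sup>+ x. ennreal (sqrt (pi / c)) * ennreal (normal_density m \<sigma> x) \<partial>lborel)"
    using assms by (simp add: ennreal_mult)
  also have "\<dots> = ennreal (sqrt (pi / c)) * (\<integral>\<^sup>+ x. ennreal (normal_density m \<sigma> x) \<partial>lborel)"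
    by (rule nn_integral_cmult) simp
  also have "(\<integral>\<^sup>+ x. ennreal (normal_density m \<sigma> x) \<partial>lborel) = 1"
    using \<sigma>(1) by (simp add: nn_integral_eq_integral integral_normal_density integrable_normal_density)
  finally show ?thesis by simp
qed

text \<open>Completing the square turns the exponential tilt into a shift of the mean by
  \<open>t * \<sigma>\<^sup>2\<close>.\<close>

lemma nn_integral_normal_density_exp:
  assumes "0 < \<sigma>"
  shows "(\<integral>\<^sup>+ x. ennreal (normal_density \<mu> \<sigma> x * exp (t * (x - \<mu>))) \<partial>lborel) = ennreal (exp (t\<^sup>2 * \<sigma>\<^sup>2 / 2))"
proof -
  have "normal_density \<mu> \<sigma> x * exp (t * (x - \<mu>)) = exp (t\<^sup>2 * \<sigma>\<^sup>2 / 2) * normal_density (\<mu> + t * \<sigma>\<^sup>2) \<sigma> x" for x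
  proof -
    have "- (x - \<mu>)\<^sup>2 / (2 * \<sigma>\<^sup>2) + t * (x - \<mu>) = t\<^sup>2 * \<sigma>\<^sup>2 / 2 + - (x - (\<mu> + t * \<sigma>\<^sup>2))\<^sup>2 / (2 * \<sigma>\<^sup>2)"
      using assms by (simp add: field_simps power2_eq_square)
    then show ?thesis
      unfolding normal_density_def by (simp add: exp_add[symmetric] mult_ac)
  qed
  then have "(\<integral>\<^sup>+ x. ennreal (normal_density \<mu> \<sigma> x * exp (t * (x - \<mu>))) \<partial>lborel)
      = (\<integral>\<^sup>+ x. ennreal (exp (t\<^sup>2 * \<sigma>\<^sup>2 / 2)) * ennreal (normal_density (\<mu> + t * \<sigma>\<^sup>2) \<sigma> x) \<partial>lborel)"
    by (simp add: ennreal_mult)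
  also have "\<dots> = ennreal (exp (t\<^sup>2 * \<sigma>\<^sup>2 / 2)) * (\<integral>\<^sup>+ x. ennreal (normal_density (\<mu> + t * \<sigma>\<^sup>2) \<sigma> x) \<partial>lborel)"
    by (rule nn_integral_cmult) simp
  also have "(\<integral>\<^sup>+ x. ennreal (normal_density (\<mu> + t * \<sigma>\<^sup>2) \<sigma> x) \<partial>lborel) = 1"
    using assms by (simp add: nn_integral_eq_integral integral_normal_density integrable_normal_density)
  finally show ?thesis by simp
qed

text \<open>
  Uniqueness of Haar measure: the integrals of \<open>h\<close> over both sides are compared by shifting, in
  the double integral of \<open>h (A z)\<close> against a Gaussian weight in \<open>y\<close>, first \<open>z\<close> and then \<open>y\<close>.
  The Gaussian is invariant under \<open>A\<close>, which fixes the constant.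
\<close>

lemma nn_integral_PiM_lborel_orthogonal:
  fixes A :: "nat \<Rightarrow> nat \<Rightarrow> real"
  assumes fin: "finite I" "finite T" and card: "card I = card T"
    and cols: "\<And>t s. t \<in> T \<Longrightarrow> s \<in> T \<Longrightarrow> (\<Sum>i\<in>I. A i t * A i s) = (if t = s then 1 else 0)"
    and rows: "\<And>i j. i \<in> I \<Longrightarrow> j \<in> I \<Longrightarrow> (\<Sum>t\<in>T. A i t * A j t) = (if i = j then 1 else 0)"
    and h[measurable]: "h \<in> borel_measurable (\<Pi>\<^sub>M i\<in>I. lborel)"
  shows "(\<integral>\<^sup>+ z. h (\<lambda>i\<in>I. \<Sum>t\<in>T. A i t * z t) \<partial>(\<Pi>\<^sub>M t\<in>T. lborel)) = (\<integral>\<^sup>+ y. h y \<partial>(\<Pi>\<^sub>M i\<in>I. lborel))"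
proof -
  define LT LI where "LT = (\<Pi>\<^sub>M t\<in>T. lborel :: real measure)" and "LI = (\<Pi>\<^sub>M i\<in>I. lborel :: real measure)"
  interpret LT: sigma_finite_measure LT unfolding LT_def by (rule lborel_real.sigma_finite[OF fin(2)])
  interpret LI: sigma_finite_measure LI unfolding LI_def by (rule lborel_real.sigma_finite[OF fin(1)])
  interpret LP: pair_sigma_finite LT LI ..
  define B where "B z = (\<lambda>i\<in>I. \<Sum>t\<in>T. A i t * z t)" for z
  define q where "q y = ennreal (exp (- (\<Sum>i\<in>I. (y i)\<^sup>2)))" for y :: "nat \<Rightarrow> real"
  have B_meas[measurable]: "B \<in> measurable LT LI"
    unfolding B_def LT_def LI_def by (rule measurable_restrict) measurable
  have q_meas[measurable]: "q \<in> borel_measurable LI"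
    unfolding q_def LI_def by measurable
  have h_meas[measurable]: "h \<in> borel_measurable LI"
    unfolding LI_def by (rule h)
  have comp: "(\<lambda>p. f p i) \<in> borel_measurable N"
    if "f \<in> measurable N LI" "i \<in> I" for f i and N :: "'b measure"
    using measurable_compose[OF that(1)[unfolded LI_def] measurable_component_singleton[OF that(2)]] by simp
  have plus_meas[measurable]: "(\<lambda>p. \<lambda>i\<in>I. f p i + g p i) \<in> measurable N LI"
    and minus_meas[measurable]: "(\<lambda>p. \<lambda>i\<in>I. f p i - g p i) \<in> measurable N LI"
    if "f \<in> measurable N LI" "g \<in> measurable N LI" for f g and N :: "'b measure"
    unfolding LI_def
    by (rule measurable_restrict, use comp[OF that(1)] comp[OF that(2)] in simp)+
  have B_component[measurable]: "(\<lambda>z. B z i) \<in> borel_measurable LT" if "i \<in> I" for i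
    by (rule comp[OF B_meas that])
  have gauss: "(\<integral>\<^sup>+ y. ennreal (exp (- (\<Sum>i\<in>J. (y i)\<^sup>2))) \<partial>(\<Pi>\<^sub>M i\<in>J. lborel :: real measure)) = ennreal (sqrt pi) ^ card J"
    if "finite J" for J :: "nat set"
  proof -
    have "ennreal (exp (- (\<Sum>i\<in>J. (y i)\<^sup>2))) = (\<Prod>i\<in>J. ennreal (exp (- 1 * (y i)\<^sup>2)))" for y :: "nat \<Rightarrow> real"
      using that by (simp add: prod_ennreal exp_sum sum_negf[symmetric])
    then have "(\<integral>\<^sup>+ y. ennreal (exp (- (\<Sum>i\<in>J. (y i)\<^sup>2))) \<partial>(\<Pi>\<^sub>M i\<in>J. lborel :: real measure))
       = (\<Prod>i\<in>J. (\<integral>\<^sup>+ x. ennreal (exp (- 1 * x\<^sup>2)) \<partial>lborel))"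
      using that by (simp only:) (rule lborel_real.product_nn_integral_prod, auto)
    also have "\<dots> = ennreal (sqrt pi) ^ card J"
      using nn_integral_gaussian[of 1 0] by simp
    finally show ?thesis .
  qed
  define G where "G = ennreal (sqrt pi) ^ card I"
  have qI: "(\<integral>\<^sup>+ y. q y \<partial>LI) = G" unfolding q_def LI_def G_def by (rule gauss[OF fin(1)])
  have norm_B: "(\<Sum>i\<in>I. (B z i)\<^sup>2) = (\<Sum>t\<in>T. (z t)\<^sup>2)" for z
  proof -
    have "(\<Sum>i\<in>I. (B z i)\<^sup>2) = (\<Sum>i\<in>I. \<Sum>t\<in>T. \<Sum>s\<in>T. (A i t * A i s) * (z t * z s))"
      unfolding B_def power2_eq_square by (simp add: sum_product mult_ac)
    also have "\<dots> = (\<Sum>t\<in>T. \<Sum>i\<in>I. \<Sum>s\<in>T. (A i t * A i s) * (z t * z s))"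
      by (rule sum.swap)
    also have "\<dots> = (\<Sum>t\<in>T. \<Sum>s\<in>T. \<Sum>i\<in>I. (A i t * A i s) * (z t * z s))"
      by (rule sum.cong[OF refl], rule sum.swap)
    also have "\<dots> = (\<Sum>t\<in>T. \<Sum>s\<in>T. if t = s then z t * z s else 0)"
      using cols by (intro sum.cong refl) (simp add: sum_distrib_right[symmetric])
    also have "\<dots> = (\<Sum>t\<in>T. (z t)\<^sup>2)"
      using fin by (simp add: power2_eq_square)
    finally show ?thesis .
  qed
  have qT: "(\<integral>\<^sup>+ z. q (B z) \<partial>LT) = G"
    unfolding q_def norm_B LT_def G_def card by (rule gauss[OF fin(2)])
  \<comment> \<open>Orthonormal rows make the transpose a right inverse of \<open>A\<close>, so that
    a shift of the image by \<open>c * y\<close> comes from a shift of \<open>z\<close>. It is used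
    below with \<open>c = 1\<close> and \<open>c = - 1\<close>.\<close>
  have B_shift: "(\<lambda>i\<in>I. B z i + c * y i) = B (\<lambda>t\<in>T. z t + c * (\<Sum>j\<in>I. A j t * y j))" for z y c
  proof -
    have "(\<Sum>t\<in>T. A i t * (\<Sum>j\<in>I. A j t * y j)) = y i" if "i \<in> I" for i
    proof -
      have "(\<Sum>t\<in>T. A i t * (\<Sum>j\<in>I. A j t * y j)) = (\<Sum>t\<in>T. \<Sum>j\<in>I. (A i t * A j t) * y j)"
        by (simp add: sum_distrib_left mult_ac)
      also have "\<dots> = (\<Sum>j\<in>I. (\<Sum>t\<in>T. A i t * A j t) * y j)"
        by (simp add: sum_distrib_right) (rule sum.swap)
      also have "\<dots> = (\<Sum>j\<in>I. if i = j then y j else 0)"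
        using rows that by (intro sum.cong) auto
      finally show ?thesis using that fin by simp
    qed
    then have "(\<Sum>t\<in>T. A i t * (c * (\<Sum>j\<in>I. A j t * y j))) = c * y i" if "i \<in> I" for i
      using that by (simp add: sum_distrib_left[symmetric] mult.left_commute[of _ c])
    then show ?thesis
      unfolding B_def by (auto simp: fun_eq_iff distrib_left sum.distrib)
  qed
  have shift_T: "(\<integral>\<^sup>+ z. k (\<lambda>i\<in>I. B z i + c * y i) \<partial>LT) = (\<integral>\<^sup>+ z. k (B z) \<partial>LT)"
    if [measurable]: "k \<in> borel_measurable LI" for k :: "(nat \<Rightarrow> real) \<Rightarrow> ennreal" and y c
    unfolding B_shift LT_def
    by (rule nn_integral_PiM_lborel_translate[OF fin(2), of "\<lambda>z. k (B z)"])
      (unfold LT_def[symmetric], measurable)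
  have q_sym: "q (\<lambda>i\<in>I. y i - x i) = q (\<lambda>i\<in>I. x i - y i)" for x y
    unfolding q_def by (simp add: power2_commute)
  have restr: "(\<lambda>i\<in>I. y i) = y" if "y \<in> space LI" for y
    using that unfolding LI_def by (auto simp: space_PiM)
  have "(\<integral>\<^sup>+ z. h (B z) \<partial>LT) * G = (\<integral>\<^sup>+ y. (\<integral>\<^sup>+ z. h (B z) \<partial>LT) * q y \<partial>LI)"
    using qI by (simp add: nn_integral_cmult)
  also have "\<dots> = (\<integral>\<^sup>+ y. (\<integral>\<^sup>+ z. h (\<lambda>i\<in>I. B z i + y i) * q y \<partial>LT) \<partial>LI)"
  proof (rule nn_integral_cong)
    fix y assume y: "y \<in> space LI"
    show "(\<integral>\<^sup>+ z. h (B z) \<partial>LT) * q y = (\<integral>\<^sup>+ z. h (\<lambda>i\<in>I. B z i + y i) * q y \<partial>LT)"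
      using y shift_T[of h 1 y] by (subst nn_integral_multc) simp_all
  qed
  also have "\<dots> = (\<integral>\<^sup>+ z. (\<integral>\<^sup>+ y. h (\<lambda>i\<in>I. B z i + y i) * q y \<partial>LI) \<partial>LT)"
    by (rule LP.Fubini') measurable
  also have "\<dots> = (\<integral>\<^sup>+ z. (\<integral>\<^sup>+ y. h y * q (\<lambda>i\<in>I. y i - B z i) \<partial>LI) \<partial>LT)"
  proof (rule nn_integral_cong)
    fix z assume z: "z \<in> space LT"
    have "(\<integral>\<^sup>+ y. h y * q (\<lambda>i\<in>I. y i - B z i) \<partial>LI)
        = (\<integral>\<^sup>+ y. h (\<lambda>i\<in>I. y i + B z i) * q (\<lambda>i\<in>I. (\<lambda>i\<in>I. y i + B z i) i - B z i) \<partial>LI)"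
      unfolding LI_def using z
      by (intro nn_integral_PiM_lborel_translate[OF fin(1), symmetric]) (unfold LI_def[symmetric], measurable)
    also have "\<dots> = (\<integral>\<^sup>+ y. h (\<lambda>i\<in>I. B z i + y i) * q y \<partial>LI)"
    proof (rule nn_integral_cong)
      fix y assume "y \<in> space LI"
      have "(\<lambda>i\<in>I. (\<lambda>i\<in>I. y i + B z i) i - B z i) = (\<lambda>i\<in>I. y i)" by (auto simp: fun_eq_iff)
      then show "h (\<lambda>i\<in>I. y i + B z i) * q (\<lambda>i\<in>I. (\<lambda>i\<in>I. y i + B z i) i - B z i)
        = h (\<lambda>i\<in>I. B z i + y i) * q y"
        by (simp add: restr[OF \<open>y \<in> space LI\<close>] add.commute)
    qed
    finally show "(\<integral>\<^sup>+ y. h (\<lambda>i\<in>I. B z i + y i) * q y \<partial>LI) = (\<integral>\<^sup>+ y. h y * q (\<lambda>i\<in>I. y i - B z i) \<partial>LI)"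
      by simp
  qed
  also have "\<dots> = (\<integral>\<^sup>+ y. (\<integral>\<^sup>+ z. h y * q (\<lambda>i\<in>I. B z i - y i) \<partial>LT) \<partial>LI)"
    unfolding q_sym[of _ "B _"] by (rule LP.Fubini'[symmetric]) measurable
  also have "\<dots> = (\<integral>\<^sup>+ y. h y * G \<partial>LI)"
  proof (rule nn_integral_cong)
    fix y assume y: "y \<in> space LI"
    have "(\<integral>\<^sup>+ z. q (\<lambda>i\<in>I. B z i - y i) \<partial>LT) = G"
      using shift_T[of q "-1" y] qT by simp
    then show "(\<integral>\<^sup>+ z. h y * q (\<lambda>i\<in>I. B z i - y i) \<partial>LT) = h y * G"
      using y by (subst nn_integral_cmult) simp_all
  qed
  also have "\<dots> = (\<integral>\<^sup>+ y. h y \<partial>LI) * G"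
    by (rule nn_integral_multc) measurable
  finally have eq: "(\<integral>\<^sup>+ z. h (B z) \<partial>LT) * G = (\<integral>\<^sup>+ y. h y \<partial>LI) * G" .
  \<comment> \<open>Cancellation in \<open>ennreal\<close> requires a factor that is neither zero
    nor infinite.\<close>
  have "G = ennreal (sqrt pi ^ card I)" "0 < sqrt pi ^ card I"
    unfolding G_def by (simp_all add: ennreal_power)
  then have "G \<noteq> 0" "G \<noteq> \<infinity>" by auto
  then have "(\<integral>\<^sup>+ z. h (B z) \<partial>LT) = (\<integral>\<^sup>+ y. h y \<partial>LI)"
    using eq by (metis ennreal_mult_cancel_left mult.commute infinity_ennreal_def)
  then show ?thesis unfolding B_def LT_def LI_def .
qed

section \<open>The Whittle measure in Fourier coordinates\<close>

lemma fourier_mat_rows_orthonormal: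
  assumes "0 < n" "i < n" "j < n"
  shows "(\<Sum>t=1..n. fourier_mat n i t * fourier_mat n j t) = (if i = j then 1 else 0)"
proof (rule rows_orthonormal_if_columns_orthonormal[where I = "{..<n}"])
  show "(\<Sum>i<n. fourier_mat n i t * fourier_mat n i s) = (if t = s then 1 else 0)"
    if "t \<in> {1..n}" "s \<in> {1..n}" for t s
    by (rule fourier_mat_columns_orthonormal[OF assms(1) that])
qed (use assms in auto)

lemma nn_integral_fourier_data:
  assumes "0 < n" "h \<in> borel_measurable (\<Pi>\<^sub>M i\<in>{..<n}. lborel)"
  shows "(\<integral>\<^sup>+ z. h (\<lambda>i\<in>{..<n}. fourier_data n z i) \<partial>(\<Pi>\<^sub>M t\<in>{1..n}. lborel)) = (\<integral>\<^sup>+ y. h y \<partial>(\<Pi>\<^sub>M i\<in>{..<n}. lborel))"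
  unfolding fourier_data_def
proof (rule nn_integral_PiM_lborel_orthogonal)
  show "(\<Sum>i<n. fourier_mat n i t * fourier_mat n i s) = (if t = s then 1 else 0)"
    if "t \<in> {1..n}" "s \<in> {1..n}" for t s
    by (rule fourier_mat_columns_orthonormal[OF assms(1) that])
  show "(\<Sum>t=1..n. fourier_mat n i t * fourier_mat n j t) = (if i = j then 1 else 0)"
    if "i \<in> {..<n}" "j \<in> {..<n}" for i j
    using fourier_mat_rows_orthonormal[OF assms(1)] that by simp
qed (use assms in simp_all)

text \<open>Parseval's identity, from the orthonormal columns: \<open>|X x|\<close> may be computed
  in either domain.\<close>

lemma sum_fourier_design_squares:
  fixes X :: "'r::finite design"
  assumes "0 < n"
  shows "(\<Sum>i<n. (fourier_design X n i \<bullet> x)\<^sup>2) = (\<Sum>t=1..n. (X n t \<bullet> x)\<^sup>2)"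
proof -
  let ?F = "fourier_mat n" and ?y = "\<lambda>t. X n t \<bullet> x"
  have "(\<Sum>i<n. (fourier_design X n i \<bullet> x)\<^sup>2) = (\<Sum>i<n. \<Sum>t=1..n. \<Sum>s=1..n. (?F i t * ?F i s) * (?y t * ?y s))"
    unfolding fourier_design_def power2_eq_square inner_sum_left sum_product by (simp add: mult_ac)
  also have "\<dots> = (\<Sum>t=1..n. \<Sum>i<n. \<Sum>s=1..n. (?F i t * ?F i s) * (?y t * ?y s))"
    by (rule sum.swap)
  also have "\<dots> = (\<Sum>t=1..n. \<Sum>s=1..n. \<Sum>i<n. (?F i t * ?F i s) * (?y t * ?y s))"
    by (rule sum.cong[OF refl], rule sum.swap)
  also have "\<dots> = (\<Sum>t=1..n. \<Sum>s=1..n. if t = s then ?y t * ?y s else 0)"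
    using fourier_mat_columns_orthonormal[OF assms]
    by (intro sum.cong refl) (simp add: sum_distrib_right[symmetric])
  finally show ?thesis by (simp add: power2_eq_square)
qed

lemma borel_measurable_fourier_data [measurable]:
  "(\<lambda>z. fourier_data n z i) \<in> borel_measurable (\<Pi>\<^sub>M t\<in>{1..n}. lborel)"
  unfolding fourier_data_def by measurable

text \<open>A diagonal covariance makes the Fourier coordinates independent, so that expectations
  reduce to one-dimensional normal integrals.\<close>

lemma whittle_density_eq_prod_normal_density:
  assumes "\<And>i. i < n \<Longrightarrow> 0 < whittle_diag n f i"
  shows "whittle_density X n \<theta> f z =
    (\<Prod>i<n. normal_density (fourier_design X n i \<bullet> \<theta>) (sqrt (whittle_diag n f i)) (fourier_data n z i))"
proof -
  let ?d = "whittle_diag n f" and ?u = "\<lambda>i. fourier_data n z i - fourier_design X n i \<bullet> \<theta>"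
  have "(\<Prod>i<n. normal_density (fourier_design X n i \<bullet> \<theta>) (sqrt (?d i)) (fourier_data n z i))
      = (\<Prod>i<n. 1 / sqrt (2 * pi * ?d i) * exp (- (1 / 2) * ((?u i)\<^sup>2 / ?d i)))"
    using assms unfolding normal_density_def by (intro prod.cong refl) (simp add: less_imp_le)
  also have "\<dots> = 1 / (\<Prod>i<n. sqrt (2 * pi * ?d i)) * (\<Prod>i<n. exp (- (1 / 2) * ((?u i)\<^sup>2 / ?d i)))"
    unfolding prod.distrib prod_dividef by simp
  also have "(\<Prod>i<n. exp (- (1 / 2) * ((?u i)\<^sup>2 / ?d i))) = exp (- (1 / 2) * (\<Sum>i<n. (?u i)\<^sup>2 / ?d i))"
    unfolding sum_distrib_left by (simp only: exp_sum[OF finite_lessThan])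
  also have "(\<Prod>i<n. sqrt (2 * pi * ?d i)) = sqrt ((2 * pi) ^ n * (\<Prod>i<n. ?d i))"
  proof -
    have "(\<Prod>i<m. sqrt (g i)) = sqrt (\<Prod>i<m. g i)" for g :: "nat \<Rightarrow> real" and m
      by (induction m) (simp_all add: real_sqrt_mult)
    then show ?thesis by (simp add: prod.distrib)
  qed
  finally show ?thesis unfolding whittle_density_def by simp
qed

lemma whittle_density_pos:
  assumes "\<And>i. i < n \<Longrightarrow> 0 < whittle_diag n f i"
  shows "0 < whittle_density X n \<theta> f z"
  unfolding whittle_density_def using assms by (auto intro!: divide_pos_pos mult_pos_pos prod_pos)

text \<open>
  The absolute first moment is bounded by exponential moments, through
  \<open>\<bar>x\<bar> \<le> exp x + exp (- x)\<close>; these factorize over the coordinates.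
\<close>

lemma nn_integral_abs_linear_whittle_measure:
  fixes X :: "'r::finite design"
  assumes n: "0 < n" and d: "\<And>i. i < n \<Longrightarrow> 0 < whittle_diag n f i" and s: "0 < s" and "k \<le> n"
    and var: "(\<Sum>i<k. (v i)\<^sup>2 * whittle_diag n f i) \<le> s\<^sup>2"
  shows "(\<integral>\<^sup>+ z. ennreal \<bar>\<Sum>i<k. (fourier_data n z i - fourier_design X n i \<bullet> \<theta>) * v i\<bar> \<partial>whittle_measure X n \<theta> f)
    \<le> ennreal (2 * exp (1 / 2) * s)"
proof -
  \<comment> \<open>Padding the coefficients by zeros lets a partial sum be integrated over all
    \<open>n\<close> coordinates at once.\<close>
  define c where "c i = (if i < k then v i else 0)" for i
  let ?L = "\<Pi>\<^sub>M i\<in>{..<n}. lborel :: real measure"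
  define m where "m i = fourier_design X n i \<bullet> \<theta>" for i
  define d' where "d' = whittle_diag n f"
  define D where "D y = (\<Prod>i<n. normal_density (m i) (sqrt (d' i)) (y i))" for y
  have D_nonneg: "0 \<le> D y" for y unfolding D_def by (intro prod_nonneg) simp
  have dpos: "0 < d' i" if "i < n" for i using d that unfolding d'_def by simp
  have [measurable]: "D \<in> borel_measurable ?L"
    unfolding D_def by measurable
  define S where "S y = (\<Sum>i<n. c i * (y i - m i))" for y
  have [measurable]: "S \<in> borel_measurable ?L"
    unfolding S_def by measurable
  have S_eq: "(\<Sum>i<k. (y i - m i) * v i) = S y" for y
    unfolding S_def c_def using \<open>k \<le> n\<close>
    by (intro sum.mono_neutral_cong_left) (auto simp: mult.commute)
  have var': "(\<Sum>i<n. (c i)\<^sup>2 * d' i) \<le> s\<^sup>2"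
  proof -
    have "(\<Sum>i<n. (c i)\<^sup>2 * d' i) = (\<Sum>i<k. (v i)\<^sup>2 * d' i)"
      unfolding c_def using \<open>k \<le> n\<close> by (intro sum.mono_neutral_cong_right) auto
    then show ?thesis using var unfolding d'_def by simp
  qed
  \<comment> \<open>Applied with \<open>t = 1 / s\<close> and \<open>t = - 1 / s\<close>, for which
    the exponent is a variance divided by \<open>2 * s\<^sup>2\<close>, at most
    \<open>1 / 2\<close>.\<close>
  have mgf: "(\<integral>\<^sup>+ y. ennreal (D y * exp (t * S y)) \<partial>?L) \<le> ennreal (exp (1 / 2))" if t: "t\<^sup>2 = 1 / s\<^sup>2" for t
  proof -
    have "D y * exp (t * S y) = (\<Prod>i<n. normal_density (m i) (sqrt (d' i)) (y i) * exp (t * c i * (y i - m i)))" for y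
      unfolding D_def S_def prod.distrib by (simp add: exp_sum sum_distrib_left mult_ac)
    then have "ennreal (D y * exp (t * S y))
        = (\<Prod>i<n. ennreal (normal_density (m i) (sqrt (d' i)) (y i) * exp (t * c i * (y i - m i))))" for y
      by (simp add: prod_ennreal)
    then have "(\<integral>\<^sup>+ y. ennreal (D y * exp (t * S y)) \<partial>?L)
        = (\<Prod>i<n. \<integral>\<^sup>+ x. ennreal (normal_density (m i) (sqrt (d' i)) x * exp (t * c i * (x - m i))) \<partial>lborel)"
      by (simp only:) (rule lborel_real.product_nn_integral_prod, auto)
    also have "\<dots> = (\<Prod>i<n. ennreal (exp ((t * c i)\<^sup>2 * d' i / 2)))"
      using dpos by (intro prod.cong refl) (simp add: nn_integral_normal_density_exp less_imp_le)
    also have "\<dots> = ennreal (exp (\<Sum>i<n. (t * c i)\<^sup>2 * d' i / 2))"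
      by (simp add: prod_ennreal exp_sum)
    also have "(\<Sum>i<n. (t * c i)\<^sup>2 * d' i / 2) = (\<Sum>i<n. (c i)\<^sup>2 * d' i) / (2 * s\<^sup>2)"
    proof -
      have "(t * c i)\<^sup>2 * d' i / 2 = (c i)\<^sup>2 * d' i / (2 * s\<^sup>2)" for i
        unfolding power_mult_distrib t by simp
      then show ?thesis by (simp only: sum_divide_distrib)
    qed
    also have "ennreal (exp \<dots>) \<le> ennreal (exp (1 / 2))"
      using var' s by (intro ennreal_leI) (simp add: divide_le_eq)
    finally show ?thesis .
  qed
  have bound: "D y * \<bar>S y\<bar> \<le> s * (D y * exp (1 / s * S y)) + s * (D y * exp (- (1 / s) * S y))" for y
  proof -
    have "\<bar>x\<bar> \<le> exp x + exp (- x)" for x :: real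
      using exp_ge_add_one_self[of x] exp_ge_add_one_self[of "- x"] exp_gt_zero[of x] exp_gt_zero[of "- x"]
      by linarith
    from this[of "S y / s"] have "\<bar>S y\<bar> \<le> s * (exp (S y / s) + exp (- (S y / s)))"
      using s by (simp add: pos_divide_le_eq mult.commute)
    then have "D y * \<bar>S y\<bar> \<le> D y * (s * (exp (S y / s) + exp (- (S y / s))))"
      by (rule mult_left_mono[OF _ D_nonneg])
    then show ?thesis by (simp add: algebra_simps)
  qed
  have dens: "whittle_density X n \<theta> f z = D (\<lambda>i\<in>{..<n}. fourier_data n z i)" for z
    using whittle_density_eq_prod_normal_density[OF d, of X \<theta> z] unfolding D_def m_def d'_def by simp
  have lin: "(\<Sum>i<k. (fourier_data n z i - fourier_design X n i \<bullet> \<theta>) * v i) = S (\<lambda>i\<in>{..<n}. fourier_data n z i)" for z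
    unfolding S_eq[symmetric] m_def using \<open>k \<le> n\<close> by (intro sum.cong) auto
  have [measurable]: "(\<lambda>z. \<lambda>i\<in>{..<n}. fourier_data n z i) \<in> measurable (\<Pi>\<^sub>M t\<in>{1..n}. lborel) ?L"
    by (rule measurable_restrict) measurable
  have "(\<integral>\<^sup>+ z. ennreal \<bar>\<Sum>i<k. (fourier_data n z i - fourier_design X n i \<bullet> \<theta>) * v i\<bar> \<partial>whittle_measure X n \<theta> f)
      = (\<integral>\<^sup>+ z. ennreal (D (\<lambda>i\<in>{..<n}. fourier_data n z i)) * ennreal \<bar>S (\<lambda>i\<in>{..<n}. fourier_data n z i)\<bar>
          \<partial>(\<Pi>\<^sub>M t\<in>{1..n}. lborel))"
    unfolding whittle_measure_def dens lin by (rule nn_integral_density) measurable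
  also have "\<dots> = (\<integral>\<^sup>+ y. ennreal (D y) * ennreal \<bar>S y\<bar> \<partial>?L)"
    by (rule nn_integral_fourier_data[OF n, of "\<lambda>y. ennreal (D y) * ennreal \<bar>S y\<bar>"]) measurable
  also have "\<dots> \<le> (\<integral>\<^sup>+ y. ennreal s * ennreal (D y * exp (1 / s * S y)) + ennreal s * ennreal (D y * exp (- (1 / s) * S y)) \<partial>?L)"
  proof (rule nn_integral_mono)
    fix y
    have "ennreal (D y) * ennreal \<bar>S y\<bar> = ennreal (D y * \<bar>S y\<bar>)"
      using D_nonneg by (simp add: ennreal_mult)
    also have "\<dots> \<le> ennreal (s * (D y * exp (1 / s * S y)) + s * (D y * exp (- (1 / s) * S y)))"
      by (rule ennreal_leI[OF bound])
    also have "\<dots> = ennreal s * ennreal (D y * exp (1 / s * S y)) + ennreal s * ennreal (D y * exp (- (1 / s) * S y))"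
      using s D_nonneg by (simp add: ennreal_mult)
    finally show "ennreal (D y) * ennreal \<bar>S y\<bar>
      \<le> ennreal s * ennreal (D y * exp (1 / s * S y)) + ennreal s * ennreal (D y * exp (- (1 / s) * S y))" .
  qed
  also have "\<dots> = ennreal s * (\<integral>\<^sup>+ y. ennreal (D y * exp (1 / s * S y)) \<partial>?L)
      + ennreal s * (\<integral>\<^sup>+ y. ennreal (D y * exp (- (1 / s) * S y)) \<partial>?L)"
    by (simp add: nn_integral_add nn_integral_cmult)
  also have "\<dots> \<le> ennreal s * ennreal (exp (1 / 2)) + ennreal s * ennreal (exp (1 / 2))"
    by (intro add_mono mult_left_mono mgf) (simp_all add: power_divide)
  also have "\<dots> = ennreal (s * exp (1 / 2) + s * exp (1 / 2))"
    using s by (simp add: ennreal_mult[symmetric] ennreal_plus[symmetric] del: ennreal_plus)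
  also have "s * exp (1 / 2) + s * exp (1 / 2) = 2 * exp (1 / 2) * s" by simp
  finally show ?thesis .
qed

section \<open>The design\<close>

lemma symmetric_matrix_inner:
  fixes A :: "real ^ 'r::finite ^ 'r"
  assumes "transpose A = A"
  shows "(A *v x) \<bullet> y = x \<bullet> (A *v y)"
  by (metis assms dot_lmul_matrix transpose_matrix_vector)

text \<open>Eigenvectors of distinct eigenvalues are orthogonal, and a pairwise orthogonal set in
  finite dimension is finite. Finiteness gives \<open>Min\<close> and \<open>Max\<close> in
  \<open>eig_min\<close> and \<open>eig_max\<close> their meaning.\<close>

lemma finite_eigenvalues:
  fixes A :: "real ^ 'r::finite ^ 'r"
  assumes A: "transpose A = A"
  shows "finite (eigenvalues A)"
proof -
  define v where "v c = (SOME v. v \<noteq> 0 \<and> A *v v = c *\<^sub>R v)" for c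
  have v: "v c \<noteq> 0 \<and> A *v v c = c *\<^sub>R v c" if "c \<in> eigenvalues A" for c
    using that unfolding eigenvalues_def v_def mem_Collect_eq by (rule someI_ex)
  have orth: "v c \<bullet> v c' = 0" if "c \<in> eigenvalues A" "c' \<in> eigenvalues A" "c \<noteq> c'" for c c'
  proof -
    have "c * (v c \<bullet> v c') = c' * (v c \<bullet> v c')"
      using symmetric_matrix_inner[OF A, of "v c" "v c'"] v[OF that(1)] v[OF that(2)] by simp
    then show ?thesis using that(3) by simp
  qed
  have "inj_on v (eigenvalues A)"
    by (rule inj_onI) (metis orth v inner_eq_zero_iff)
  moreover have "pairwise orthogonal (v ` eigenvalues A)"
    using orth by (fastforce simp: pairwise_def orthogonal_def)
  ultimately show ?thesis
    using pairwise_orthogonal_imp_finite finite_imageD by blast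
qed

text \<open>A minimizer of the quadratic form on the unit sphere is an eigenvector: otherwise a
  small step against the residual \<open>A *v v - c *\<^sub>R v\<close> would bring the quotient
  below its minimum.\<close>

lemma rayleigh_minimum_eigenvalue:
  fixes A :: "real ^ 'r::finite ^ 'r"
  assumes A: "transpose A = A"
  obtains c where "c \<in> eigenvalues A" "\<And>x. c * (norm x)\<^sup>2 \<le> x \<bullet> (A *v x)"
proof -
  let ?q = "\<lambda>x. x \<bullet> (A *v x)"
  have "continuous_on (sphere 0 1) ?q"
    by (intro continuous_intros matrix_vector_mult_linear_continuous_on)
  moreover have "sphere 0 1 \<noteq> ({} :: (real ^ 'r) set)"
    using norm_axis_1 by (auto intro!: exI[of _ "axis undefined 1"])
  ultimately obtain v where v: "norm v = 1" "\<And>x. norm x = 1 \<Longrightarrow> ?q v \<le> ?q x"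
    using continuous_attains_inf[of "sphere 0 1" ?q] by auto
  define c where "c = ?q v"
  have q_ge: "c * (norm x)\<^sup>2 \<le> ?q x" for x
  proof (cases "x = 0")
    case False
    have "c \<le> ?q (x /\<^sub>R norm x)" unfolding c_def using False by (intro v(2)) simp
    also have "\<dots> = ?q x / (norm x)\<^sup>2"
      by (simp add: matrix_vector_mult_scaleR power2_eq_square divide_inverse)
    finally show ?thesis using False by (simp add: field_simps)
  qed simp
  define w where "w = A *v v - c *\<^sub>R v"
  define K where "K = ?q w - c * (norm w)\<^sup>2"
  have K: "0 \<le> K" using q_ge[of w] unfolding K_def by simp
  have expand: "?q (v + t *\<^sub>R w) - c * (norm (v + t *\<^sub>R w))\<^sup>2 = 2 * t * (norm w)\<^sup>2 + t\<^sup>2 * K" for t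
  proof -
    have "v \<bullet> (A *v w) = w \<bullet> (A *v v)"
      using symmetric_matrix_inner[OF A, of v w] by (simp add: inner_commute)
    then have q1: "?q (v + t *\<^sub>R w) = c + 2 * t * (w \<bullet> (A *v v)) + t\<^sup>2 * ?q w"
      unfolding c_def
      by (simp add: matrix_vector_right_distrib matrix_vector_mult_scaleR inner_add_left inner_add_right power2_eq_square algebra_simps)
    have q2: "(norm (v + t *\<^sub>R w))\<^sup>2 = 1 + 2 * t * (w \<bullet> v) + t\<^sup>2 * (norm w)\<^sup>2"
      using v(1) unfolding power2_norm_eq_inner norm_eq_1
      by (simp add: inner_add_left inner_add_right inner_commute power2_eq_square)
    have q3: "(norm w)\<^sup>2 = w \<bullet> (A *v v) - c * (w \<bullet> v)"
      by (simp add: power2_norm_eq_inner) (simp add: w_def inner_diff_right)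
    show ?thesis unfolding q1 q2 K_def q3 by (simp add: algebra_simps)
  qed
  have "norm w = 0"
  proof (rule ccontr)
    assume "norm w \<noteq> 0"
    then have pos: "0 < (norm w)\<^sup>2" by simp
    \<comment> \<open>A step this short keeps the term linear in \<open>t\<close> dominant, as
      \<open>K / (K + 1)\<close> is below \<open>1\<close>; the added \<open>1\<close> covers
      \<open>K = 0\<close>.\<close>
    define t where "t = - (norm w)\<^sup>2 / (K + 1)"
    have "0 \<le> t * (2 * (norm w)\<^sup>2 + t * K)"
      using q_ge[of "v + t *\<^sub>R w"] expand[of t] by (simp add: algebra_simps power2_eq_square)
    moreover have "t < 0" unfolding t_def using pos K by simp
    moreover have "0 < 2 * (norm w)\<^sup>2 + t * K"
    proof -
      have "(norm w)\<^sup>2 * (K / (K + 1)) \<le> (norm w)\<^sup>2 * 1"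
        using K by (intro mult_left_mono) simp_all
      moreover have "t * K = - ((norm w)\<^sup>2 * (K / (K + 1)))" unfolding t_def by simp
      ultimately show ?thesis using pos by linarith
    qed
    ultimately show False by (smt (verit) mult_neg_pos)
  qed
  then have "A *v v = c *\<^sub>R v" unfolding w_def by simp
  moreover have "v \<noteq> 0" using v(1) by auto
  ultimately have "c \<in> eigenvalues A" unfolding eigenvalues_def by auto
  then show thesis using q_ge that by blast
qed

lemma eig_min_le_rayleigh:
  fixes A :: "real ^ 'r::finite ^ 'r"
  assumes A: "transpose A = A"
  shows "eig_min A * (norm x)\<^sup>2 \<le> x \<bullet> (A *v x)"
proof -
  obtain c where c: "c \<in> eigenvalues A" "c * (norm x)\<^sup>2 \<le> x \<bullet> (A *v x)"
    using rayleigh_minimum_eigenvalue[OF A] by metis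
  have "eig_min A \<le> c" unfolding eig_min_def using finite_eigenvalues[OF A] c(1) by simp
  then have "eig_min A * (norm x)\<^sup>2 \<le> c * (norm x)\<^sup>2" by (rule mult_right_mono) simp
  then show ?thesis using c(2) by simp
qed

text \<open>Passing to \<open>- A\<close> turns the maximum into the minimum already
  treated.\<close>

lemma rayleigh_le_eig_max:
  fixes A :: "real ^ 'r::finite ^ 'r"
  assumes A: "transpose A = A"
  shows "x \<bullet> (A *v x) \<le> eig_max A * (norm x)\<^sup>2"
proof -
  have neg: "(- A) *v y = - (A *v y)" for y
    by (simp add: matrix_vector_mult_def vec_eq_iff sum_negf)
  have "transpose (- A) = - A" using A by (simp add: transpose_def vec_eq_iff)
  then obtain c where c: "c \<in> eigenvalues (- A)" "c * (norm x)\<^sup>2 \<le> x \<bullet> ((- A) *v x)"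
    using rayleigh_minimum_eigenvalue by metis
  have "- c \<in> eigenvalues A"
  proof -
    obtain v where "v \<noteq> 0" "- (A *v v) = c *\<^sub>R v"
      using c(1) unfolding eigenvalues_def neg by blast
    moreover from this have "A *v v = (- c) *\<^sub>R v"
      by (metis minus_minus scaleR_minus_left)
    ultimately show ?thesis unfolding eigenvalues_def by blast
  qed
  then have "- c \<le> eig_max A" unfolding eig_max_def using finite_eigenvalues[OF A] by simp
  then have "- c * (norm x)\<^sup>2 \<le> eig_max A * (norm x)\<^sup>2" by (rule mult_right_mono) simp
  then show ?thesis using c(2) by (simp add: neg)
qed

section \<open>The Gram matrix of the design\<close>

lemma transpose_gram: "transpose (gram X n) = gram X n"
  by (simp add: transpose_def gram_def vec_eq_iff mult.commute)

lemma inner_gram: "x \<bullet> (gram X n *v x) = (\<Sum>t=1..n. (X n t \<bullet> x)\<^sup>2)"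
proof -
  have "x \<bullet> (gram X n *v x) = (\<Sum>a\<in>UNIV. \<Sum>b\<in>UNIV. \<Sum>t=1..n. (x $ a * X n t $ a) * (X n t $ b * x $ b))"
    by (simp add: inner_vec_def matrix_vector_mult_def gram_def sum_distrib_left sum_distrib_right mult_ac)
  also have "\<dots> = (\<Sum>a\<in>UNIV. \<Sum>t=1..n. \<Sum>b\<in>UNIV. (x $ a * X n t $ a) * (X n t $ b * x $ b))"
    by (rule sum.cong[OF refl], rule sum.swap)
  also have "\<dots> = (\<Sum>t=1..n. \<Sum>a\<in>UNIV. \<Sum>b\<in>UNIV. (x $ a * X n t $ a) * (X n t $ b * x $ b))"
    by (rule sum.swap)
  also have "\<dots> = (\<Sum>t=1..n. (X n t \<bullet> x)\<^sup>2)"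
    by (simp add: inner_vec_def power2_eq_square sum_product mult_ac)
  finally show ?thesis .
qed

lemma regular_design_norm_bounds:
  fixes X :: "'r::finite design"
  assumes "regular_design X"
  obtains a b where "0 < a" "0 < b"
    "\<forall>\<^sub>F n in sequentially. \<forall>x. a * real n * (norm x)\<^sup>2 \<le> (\<Sum>t=1..n. (X n t \<bullet> x)\<^sup>2) \<and>
       (\<Sum>t=1..n. (X n t \<bullet> x)\<^sup>2) \<le> b * real n * (norm x)\<^sup>2"
proof -
  have "0 < liminf (\<lambda>n. ereal (eig_min (gram X n) / real n))"
    and "limsup (\<lambda>n. ereal (eig_max (gram X n) / real n)) < \<infinity>"
    using assms unfolding regular_design_def by auto
  then obtain a b where a: "0 < ereal a" "ereal a < liminf (\<lambda>n. ereal (eig_min (gram X n) / real n))"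
    and b: "limsup (\<lambda>n. ereal (eig_max (gram X n) / real n)) < ereal b"
    by (blast dest: ereal_dense2)
  have ev: "\<forall>\<^sub>F n in sequentially. a < eig_min (gram X n) / real n \<and> eig_max (gram X n) / real n < b"
    using less_LiminfD[OF a(2)] Limsup_lessD[OF b] by eventually_elim simp
  have "\<forall>\<^sub>F n in sequentially. \<forall>x. a * real n * (norm x)\<^sup>2 \<le> (\<Sum>t=1..n. (X n t \<bullet> x)\<^sup>2) \<and>
       (\<Sum>t=1..n. (X n t \<bullet> x)\<^sup>2) \<le> max b 1 * real n * (norm x)\<^sup>2"
    using ev eventually_gt_at_top[of 0]
  proof eventually_elim
    case (elim n)
    have "a * real n \<le> eig_min (gram X n)" "eig_max (gram X n) \<le> b * real n"
      using elim by (simp_all add: field_simps)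
    \<comment> \<open>The choice of \<open>b\<close> above a limit superior gives no information on
      its sign; \<open>max b 1\<close> is positive.\<close>
    moreover have "b * real n \<le> max b 1 * real n" by (rule mult_right_mono) auto
    ultimately have "a * real n * (norm x)\<^sup>2 \<le> eig_min (gram X n) * (norm x)\<^sup>2"
      "eig_max (gram X n) * (norm x)\<^sup>2 \<le> max b 1 * real n * (norm x)\<^sup>2" for x :: "real ^ 'r"
      by (auto intro!: mult_right_mono)
    moreover have "eig_min (gram X n) * (norm x)\<^sup>2 \<le> (\<Sum>t=1..n. (X n t \<bullet> x)\<^sup>2)"
      "(\<Sum>t=1..n. (X n t \<bullet> x)\<^sup>2) \<le> eig_max (gram X n) * (norm x)\<^sup>2" for x
      using eig_min_le_rayleigh[OF transpose_gram, of X n x] rayleigh_le_eig_max[OF transpose_gram, of x X n]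
      unfolding inner_gram by auto
    ultimately show ?case by (meson order_trans)
  qed
  then show thesis using a(1) that[of a "max b 1"] by simp
qed

section \<open>The score, uniformly over spectral densities\<close>

text \<open>A real supremum dominates its members only over a set bounded above. For the values of
  \<open>f\<close> and its reciprocal this follows from compactness, for the difference quotients
  from the continuous derivative and the mean value inequality.\<close>

lemma spectral_class_bounds:
  assumes f: "f \<in> spectral_class \<tau>0 \<tau>1" and "0 < \<tau>0"
  shows "x \<in> {0..pi} \<Longrightarrow> \<tau>0 \<le> f x" "x \<in> {0..pi} \<Longrightarrow> f x \<le> \<tau>1"
    "x \<in> {0..pi} \<Longrightarrow> y \<in> {0..pi} \<Longrightarrow> \<bar>f x - f y\<bar> \<le> \<tau>1 * \<bar>x - y\<bar>"
proof -
  have cont: "continuous_on {0..pi} f"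
    using f by (auto simp: spectral_class_def cont_space_def space_restrict_space)
  have pos: "\<And>x. x \<in> {0..pi} \<Longrightarrow> 0 < f x"
    and inv: "(SUP x\<in>{0..pi}. \<bar>inverse (f x)\<bar>) \<le> inverse \<tau>0" and lip: "lip_norm f \<le> \<tau>1"
    using f by (auto simp: spectral_class_def sup_norm_def)
  have bdd: "bdd_above ((\<lambda>x. \<bar>h x\<bar>) ` {0..pi})" if "continuous_on {0..pi} h" for h :: "real \<Rightarrow> real"
    by (intro compact_imp_bounded[THEN bounded_imp_bdd_above] compact_continuous_image continuous_intros that) simp
  define q where "q = (\<lambda>(x, y). \<bar>f x - f y\<bar> / \<bar>x - y\<bar>)"
  define P where "P = {(x, y). x \<in> {0..pi} \<and> y \<in> {0..pi} \<and> x \<noteq> (y::real)}"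
  have "bdd_above (q ` P)"
  proof -
    obtain f' where f': "continuous_on {0..pi} f'"
      "\<And>x. x \<in> {0..pi} \<Longrightarrow> (f has_real_derivative f' x) (at x within {0..pi})"
      using f by (auto simp: spectral_class_def C1_on_interval_def)
    obtain B where B: "\<And>x. x \<in> {0..pi} \<Longrightarrow> \<bar>f' x\<bar> \<le> B"
      using bdd[OF f'(1)] unfolding bdd_above_def by blast
    have "\<bar>f x - f y\<bar> \<le> B * \<bar>x - y\<bar>" if "x \<in> {0..pi}" "y \<in> {0..pi}" for x y
      using field_differentiable_bound[OF convex_real_interval(5) f'(2) _ that(1,2), of B] B by simp
    then have "\<forall>p\<in>P. q p \<le> B"
      unfolding P_def q_def by (auto simp: divide_le_eq)
    then show ?thesis by (auto simp: bdd_above_def)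
  qed
  then have quot: "q p \<le> (SUP p\<in>P. q p)" if "p \<in> P" for p
    by (rule cSUP_upper[OF that])
  \<comment> \<open>Both summands of \<open>lip_norm\<close> are nonnegative, so that
    \<open>\<tau>1\<close> bounds each of them.\<close>
  have quot_nonneg: "0 \<le> (SUP p\<in>P. q p)"
    by (rule order_trans[OF _ quot[of "(0, pi)"]]) (auto simp: q_def P_def)
  have sup: "\<bar>f x\<bar> \<le> sup_norm f" if "x \<in> {0..pi}" for x
    unfolding sup_norm_def by (rule cSUP_upper[OF that bdd[OF cont]])
  have sup_nonneg: "0 \<le> sup_norm f"
    by (rule order_trans[OF _ sup[of 0]]) auto
  have lip_eq: "lip_norm f = sup_norm f + (SUP p\<in>P. q p)"
    unfolding lip_norm_def q_def P_def ..
  show "f x \<le> \<tau>1" if "x \<in> {0..pi}"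
    using sup[OF that] quot_nonneg lip lip_eq by linarith
  show "\<tau>0 \<le> f x" if "x \<in> {0..pi}"
  proof -
    have "continuous_on {0..pi} (\<lambda>x. inverse (f x))"
      using pos by (intro continuous_on_inverse cont) force
    then have "\<bar>inverse (f x)\<bar> \<le> inverse \<tau>0"
      using cSUP_upper[OF that bdd, of "\<lambda>x. inverse (f x)"] inv by linarith
    then show ?thesis using pos[OF that] \<open>0 < \<tau>0\<close> by simp
  qed
  show "\<bar>f x - f y\<bar> \<le> \<tau>1 * \<bar>x - y\<bar>" if "x \<in> {0..pi}" "y \<in> {0..pi}"
  proof (cases "x = y")
    case False
    have "\<bar>f x - f y\<bar> / \<bar>x - y\<bar> \<le> \<tau>1"
      using quot[of "(x, y)"] that False sup_nonneg lip lip_eq by (auto simp: q_def P_def)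
    then show ?thesis using False by (simp add: divide_le_eq)
  qed simp
qed

text \<open>Rows below \<open>n\<close> reach at most the frequency index \<open>n div 2\<close>, so
  \<open>f\<close> is evaluated only where the class controls it.\<close>

lemma fourier_frequency_in_interval:
  assumes "i < n"
  shows "2 * pi * real ((i + 1) div 2) / real n \<in> {0..pi}"
proof -
  have "2 * ((i + 1) div 2) \<le> n" using assms by presburger
  then have "pi * (2 * real ((i + 1) div 2)) \<le> pi * real n"
    by (intro mult_left_mono) (linarith, simp)
  then show ?thesis using assms by (auto simp: divide_le_eq mult_ac)
qed

lemma whittle_diag_bounds:
  assumes "f \<in> spectral_class \<tau>0 \<tau>1" "0 < \<tau>0" "i < n"
  shows "2 * pi * \<tau>0 \<le> whittle_diag n f i" "whittle_diag n f i \<le> 2 * pi * \<tau>1"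
  unfolding whittle_diag_def
  using spectral_class_bounds(1,2)[OF assms(1,2) fourier_frequency_in_interval[OF assms(3)]] by simp_all

text \<open>The \<open>2 * pi\<close> in the spacing of the frequencies cancels against the one in
  \<open>whittle_diag\<close>; what remains is the Lipschitz constant of \<open>f\<close> over a
  lower bound for \<open>f x * f y\<close>.\<close>

lemma whittle_diag_increment:
  assumes f: "f \<in> spectral_class \<tau>0 \<tau>1" and "0 < \<tau>0" and i: "Suc i < n"
  shows "\<bar>1 / whittle_diag n f (Suc i) - 1 / whittle_diag n f i\<bar> \<le> \<tau>1 / \<tau>0\<^sup>2 / real n"
proof -
  define x where "x = 2 * pi * real ((i + 1) div 2) / real n"
  define y where "y = 2 * pi * real ((Suc i + 1) div 2) / real n"
  have xy: "x \<in> {0..pi}" "y \<in> {0..pi}"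
    unfolding x_def y_def using i by (intro fourier_frequency_in_interval; simp)+
  have fx: "\<tau>0 \<le> f x" "\<tau>0 \<le> f y" using spectral_class_bounds(1)[OF assms(1,2)] xy by auto
  have "0 \<le> \<tau>1" using spectral_class_bounds(1,2)[OF assms(1,2) xy(1)] \<open>0 < \<tau>0\<close> by linarith
  \<comment> \<open>The frequency index grows by one if \<open>i\<close> is even and is unchanged if
    \<open>i\<close> is odd, the step from a cosine row to its sine row.\<close>
  have "real ((Suc i + 1) div 2) - real ((i + 1) div 2) \<in> {0..1}"
    by (cases "even i") (auto elim!: evenE oddE)
  then have "\<bar>real ((i + 1) div 2) - real ((Suc i + 1) div 2)\<bar> \<le> 1" by auto
  moreover have "x - y = 2 * pi / real n * (real ((i + 1) div 2) - real ((Suc i + 1) div 2))"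
    unfolding x_def y_def by (simp add: diff_divide_distrib algebra_simps)
  ultimately have "\<bar>x - y\<bar> \<le> \<bar>2 * pi / real n\<bar> * 1"
    by (simp only: abs_mult) (rule mult_left_mono, simp_all)
  then have "\<bar>x - y\<bar> \<le> 2 * pi / real n" by simp
  then have "\<tau>1 * \<bar>x - y\<bar> \<le> \<tau>1 * (2 * pi / real n)"
    using \<open>0 \<le> \<tau>1\<close> by (rule mult_left_mono)
  then have num: "\<bar>f x - f y\<bar> \<le> \<tau>1 * (2 * pi / real n)"
    using spectral_class_bounds(3)[OF assms(1,2) xy] by linarith
  have "1 / whittle_diag n f (Suc i) - 1 / whittle_diag n f i = (f x - f y) / (2 * pi * (f x * f y))"
    unfolding whittle_diag_def x_def[symmetric] y_def[symmetric] using fx \<open>0 < \<tau>0\<close>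
    by (simp add: field_simps)
  also have "\<bar>\<dots>\<bar> = \<bar>f x - f y\<bar> / (2 * pi * (f x * f y))"
    using fx \<open>0 < \<tau>0\<close> by (simp add: abs_mult)
  also have "\<dots> \<le> (\<tau>1 * (2 * pi / real n)) / (2 * pi * (\<tau>0 * \<tau>0))"
    using num fx \<open>0 < \<tau>0\<close> \<open>0 \<le> \<tau>1\<close> by (intro frac_le mult_left_mono mult_mono) auto
  also have "\<dots> = \<tau>1 / \<tau>0\<^sup>2 / real n"
    by (simp add: power2_eq_square)
  finally show ?thesis .
qed

text \<open>Abel summation leaves only the last weight and the increments of the weights, so that
  the bound sees \<open>w\<close> through the constants \<open>W\<close> and \<open>l\<close>
  alone.\<close>

lemma abs_sum_mult_le_partial_sums:
  fixes w s :: "nat \<Rightarrow> real"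
  assumes "0 < n" and W: "\<And>i. i < n \<Longrightarrow> \<bar>w i\<bar> \<le> W" and l: "\<And>i. Suc i < n \<Longrightarrow> \<bar>w (Suc i) - w i\<bar> \<le> l"
  shows "\<bar>\<Sum>i<n. w i * s i\<bar> \<le> W * \<bar>\<Sum>i<n. s i\<bar> + l * (\<Sum>k<n. \<bar>\<Sum>i<k. s i\<bar>)"
proof -
  define S where "S k = (\<Sum>i<k. s i)" for k
  have abel: "(\<Sum>i<Suc m. w i * s i) = w m * S (Suc m) - (\<Sum>i<m. (w (Suc i) - w i) * S (Suc i))" for m
    by (induction m) (simp_all add: S_def algebra_simps)
  obtain m where n: "n = Suc m" using \<open>0 < n\<close> gr0_implies_Suc by blast
  have "\<bar>\<Sum>i<n. w i * s i\<bar> \<le> \<bar>w m * S n\<bar> + \<bar>\<Sum>i<m. (w (Suc i) - w i) * S (Suc i)\<bar>"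
    unfolding n abel by (rule abs_triangle_ineq4)
  also have "\<bar>w m * S n\<bar> \<le> W * \<bar>S n\<bar>"
    unfolding abs_mult using W[of m] n by (intro mult_right_mono) auto
  also have "\<bar>\<Sum>i<m. (w (Suc i) - w i) * S (Suc i)\<bar> \<le> (\<Sum>i<m. \<bar>(w (Suc i) - w i) * S (Suc i)\<bar>)"
    by (rule sum_abs)
  also have "\<dots> \<le> (\<Sum>i<m. l * \<bar>S (Suc i)\<bar>)"
    unfolding abs_mult using l n by (intro sum_mono mult_right_mono) auto
  \<comment> \<open>The sums \<open>S (Suc i)\<close> are those with index \<open>1\<close> to
    \<open>m\<close>; index \<open>0\<close> may be added because \<open>S 0 = 0\<close>.\<close>
  also have "\<dots> = l * (\<Sum>k<n. \<bar>S k\<bar>)"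
    unfolding n sum.lessThan_Suc_shift by (simp add: S_def sum_distrib_left)
  finally show ?thesis unfolding S_def by simp
qed

text \<open>
  Dominates, uniformly over the class of spectral densities, the norm of the score at \<open>\<theta>\<close>:
  \<open>w\<close> bounds the weights given by \<open>1 / f\<close> and \<open>l / n\<close> their increments, so that summation by
  parts removes the weights.
\<close>

definition score_bound :: "'r::finite design \<Rightarrow> nat \<Rightarrow> real ^ 'r \<Rightarrow> real \<Rightarrow> real \<Rightarrow> (nat \<Rightarrow> real) \<Rightarrow> real" where
  "score_bound X n \<theta> w l z = (\<Sum>a\<in>UNIV.
     w * \<bar>\<Sum>i<n. (fourier_data n z i - fourier_design X n i \<bullet> \<theta>) * fourier_design X n i $ a\<bar> +
     l / real n * (\<Sum>k<n. \<bar>\<Sum>i<k. (fourier_data n z i - fourier_design X n i \<bullet> \<theta>) * fourier_design X n i $ a\<bar>))"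

text \<open>Expanding \<open>h\<close> in coordinates leaves one weighted sum per coordinate, to
  which summation by parts applies. The right-hand side no longer mentions \<open>f\<close>, so one
  event controls all \<open>f\<close>.\<close>

lemma score_le_score_bound:
  fixes X :: "'r::finite design"
  assumes f: "f \<in> spectral_class \<tau>0 \<tau>1" and "0 < \<tau>0" and n: "0 < n"
  shows "\<bar>\<Sum>i<n. (fourier_data n z i - fourier_design X n i \<bullet> \<theta>) * (fourier_design X n i \<bullet> h) / whittle_diag n f i\<bar>
    \<le> score_bound X n \<theta> (1 / (2 * pi * \<tau>0)) (\<tau>1 / \<tau>0\<^sup>2) z * norm h"
proof -
  define u where "u i = fourier_data n z i - fourier_design X n i \<bullet> \<theta>" for i
  define v where "v a i = fourier_design X n i $ a" for a i
  define w where "w i = 1 / whittle_diag n f i" for i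
  define r where "r a = (1 / (2 * pi * \<tau>0)) * \<bar>\<Sum>i<n. u i * v a i\<bar>
    + \<tau>1 / \<tau>0\<^sup>2 / real n * (\<Sum>k<n. \<bar>\<Sum>i<k. u i * v a i\<bar>)" for a
  have w: "\<bar>w i\<bar> \<le> 1 / (2 * pi * \<tau>0)" if "i < n" for i
  proof -
    have "2 * pi * \<tau>0 \<le> whittle_diag n f i" "0 < 2 * pi * \<tau>0"
      using whittle_diag_bounds(1)[OF f \<open>0 < \<tau>0\<close> that] \<open>0 < \<tau>0\<close> by simp_all
    then show ?thesis unfolding w_def by (simp add: frac_le)
  qed
  have r: "\<bar>\<Sum>i<n. w i * (u i * v a i)\<bar> \<le> r a" for a
    unfolding r_def using w whittle_diag_increment[OF f \<open>0 < \<tau>0\<close>]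
    by (intro abs_sum_mult_le_partial_sums n) (auto simp: w_def)
  have "(\<Sum>i<n. u i * (fourier_design X n i \<bullet> h) / whittle_diag n f i)
      = (\<Sum>i<n. \<Sum>a\<in>UNIV. h $ a * (w i * (u i * v a i)))"
    unfolding inner_vec_def v_def w_def by (simp add: sum_distrib_left sum_divide_distrib mult_ac)
  also have "\<dots> = (\<Sum>a\<in>UNIV. h $ a * (\<Sum>i<n. w i * (u i * v a i)))"
    by (simp only: sum_distrib_left) (rule sum.swap)
  also have "\<bar>\<dots>\<bar> \<le> (\<Sum>a\<in>UNIV. \<bar>h $ a * (\<Sum>i<n. w i * (u i * v a i))\<bar>)"
    by (rule sum_abs)
  also have "\<dots> \<le> (\<Sum>a\<in>UNIV. norm h * r a)"
    unfolding abs_mult using r component_le_norm_cart by (intro sum_mono mult_mono) auto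
  also have "\<dots> = score_bound X n \<theta> (1 / (2 * pi * \<tau>0)) (\<tau>1 / \<tau>0\<^sup>2) z * norm h"
    unfolding score_bound_def r_def u_def v_def by (simp only: sum_distrib_left mult.commute)
  finally show ?thesis unfolding u_def .
qed

lemma borel_measurable_score_bound [measurable]:
  "score_bound X n \<theta> w l \<in> borel_measurable (\<Pi>\<^sub>M t\<in>{1..n}. lborel)"
  unfolding score_bound_def by measurable

text \<open>Truncation only drops nonnegative terms of the variance, so every partial sum has
  variance at most \<open>D * V\<close>. The \<open>n\<close> partial sums of a coordinate carry
  weight \<open>l / n\<close> each and together cost as much as one with weight
  \<open>l\<close>.\<close>

lemma nn_integral_score_bound_whittle_measure:
  fixes X :: "'r::finite design"
  assumes n: "0 < n" and d: "\<And>i. i < n \<Longrightarrow> 0 < whittle_diag n f i \<and> whittle_diag n f i \<le> D"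
    and V: "\<And>x. (\<Sum>t=1..n. (X n t \<bullet> x)\<^sup>2) \<le> V * (norm x)\<^sup>2" and pos: "0 < D" "0 < V" "0 \<le> w" "0 \<le> l"
  shows "(\<integral>\<^sup>+ z. ennreal (score_bound X n \<theta> w l z) \<partial>whittle_measure X n \<theta> f)
    \<le> ennreal (real CARD('r) * ((w + l) * (2 * exp (1 / 2) * sqrt (D * V))))"
proof -
  define S where "S k a z = \<bar>\<Sum>i<k. (fourier_data n z i - fourier_design X n i \<bullet> \<theta>) * fourier_design X n i $ a\<bar>" for k a z
  define s where "s = sqrt (D * V)"
  define E where "E = 2 * exp (1 / 2) * s"
  have s: "0 < s" "s\<^sup>2 = D * V" unfolding s_def using pos by auto
  have E: "0 \<le> E" unfolding E_def using s by simp
  have [simp, measurable_cong]: "sets (whittle_measure X n \<theta> f) = sets (\<Pi>\<^sub>M t\<in>{1..n}. lborel)"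
    unfolding whittle_measure_def by simp
  have [measurable]: "S k a \<in> borel_measurable (whittle_measure X n \<theta> f)" for k a
    unfolding S_def by measurable
  have mom: "(\<integral>\<^sup>+ z. ennreal (S k a z) \<partial>whittle_measure X n \<theta> f) \<le> ennreal E" if "k \<le> n" for k a
    unfolding S_def E_def
  proof (rule nn_integral_abs_linear_whittle_measure[OF n _ s(1) that])
    have "(\<Sum>i<k. (fourier_design X n i $ a)\<^sup>2 * whittle_diag n f i) \<le> (\<Sum>i<n. (fourier_design X n i $ a)\<^sup>2 * whittle_diag n f i)"
      using d that by (intro sum_mono2) (auto intro!: mult_nonneg_nonneg simp: less_imp_le)
    also have "\<dots> \<le> (\<Sum>i<n. (fourier_design X n i $ a)\<^sup>2 * D)"
      using d by (intro sum_mono mult_left_mono) auto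
    also have "\<dots> = D * (\<Sum>i<n. (fourier_design X n i \<bullet> axis a 1)\<^sup>2)"
      by (simp add: sum_distrib_left inner_axis mult.commute)
    also have "\<dots> \<le> D * V"
      using V[of "axis a 1"] pos by (intro mult_left_mono) (simp_all add: sum_fourier_design_squares[OF n])
    finally show "(\<Sum>i<k. (fourier_design X n i $ a)\<^sup>2 * whittle_diag n f i) \<le> s\<^sup>2"
      unfolding s(2) .
  qed (use d in auto)
  have S_nonneg: "0 \<le> S k a z" for k a z unfolding S_def by simp
  have eq: "ennreal (score_bound X n \<theta> w l z)
      = (\<Sum>a\<in>UNIV. ennreal w * ennreal (S n a z) + ennreal (l / real n) * (\<Sum>k<n. ennreal (S k a z)))" for z
  proof -
    have "score_bound X n \<theta> w l z = (\<Sum>a\<in>UNIV. w * S n a z + l / real n * (\<Sum>k<n. S k a z))"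
      unfolding score_bound_def S_def ..
    then have "ennreal (score_bound X n \<theta> w l z) = (\<Sum>a\<in>UNIV. ennreal (w * S n a z + l / real n * (\<Sum>k<n. S k a z)))"
      using pos S_nonneg by (simp only:) (rule sum_ennreal[symmetric], simp add: sum_nonneg)
    moreover have "ennreal (w * s + x * t) = ennreal w * ennreal s + ennreal x * ennreal t"
      if "0 \<le> s" "0 \<le> x" "0 \<le> t" for s x t
      using that pos by (simp add: ennreal_mult)
    ultimately show ?thesis
      using pos S_nonneg by (simp only: sum_ennreal sum_nonneg divide_nonneg_nonneg of_nat_0_le_iff)
  qed
  have "(\<integral>\<^sup>+ z. ennreal (score_bound X n \<theta> w l z) \<partial>whittle_measure X n \<theta> f)
      = (\<Sum>a\<in>UNIV. ennreal w * (\<integral>\<^sup>+ z. ennreal (S n a z) \<partial>whittle_measure X n \<theta> f)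
         + ennreal (l / real n) * (\<Sum>k<n. \<integral>\<^sup>+ z. ennreal (S k a z) \<partial>whittle_measure X n \<theta> f))"
    unfolding eq by (simp add: nn_integral_sum nn_integral_add nn_integral_cmult)
  also have "\<dots> \<le> (\<Sum>a\<in>(UNIV :: 'r set). ennreal w * ennreal E + ennreal (l / real n) * (\<Sum>k<n. ennreal E))"
    by (intro sum_mono add_mono mult_left_mono mom) auto
  also have "\<dots> = (\<Sum>a\<in>(UNIV :: 'r set). ennreal ((w + l) * E))"
  proof (rule sum.cong[OF refl])
    have "(\<Sum>k<n. ennreal E) = ennreal (real n * E)"
      using E by (subst sum_ennreal) simp_all
    then have "ennreal (l / real n) * (\<Sum>k<n. ennreal E) = ennreal (l / real n * (real n * E))"
      using E pos by (simp only: ennreal_mult divide_nonneg_nonneg mult_nonneg_nonneg of_nat_0_le_iff)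
    also have "l / real n * (real n * E) = l * E" using n by simp
    finally show "ennreal w * ennreal E + ennreal (l / real n) * (\<Sum>k<n. ennreal E) = ennreal ((w + l) * E)"
      using E pos by (simp add: ennreal_mult[symmetric] ennreal_plus[symmetric] distrib_right del: ennreal_plus sum_constant)
  qed
  also have "\<dots> = ennreal (real CARD('r) * ((w + l) * E))"
    using E pos by (simp add: sum_ennreal del: sum_constant) simp
  finally show ?thesis unfolding E_def s_def .
qed

section \<open>Likelihood ratios in the regression parameter\<close>

lemma whittle_density_translate:
  "whittle_density X n (\<theta> + h) f z = whittle_density X n \<theta> f z *
     exp ((\<Sum>i<n. (fourier_data n z i - fourier_design X n i \<bullet> \<theta>) * (fourier_design X n i \<bullet> h) / whittle_diag n f i)
       - 1 / 2 * (\<Sum>i<n. (fourier_design X n i \<bullet> h)\<^sup>2 / whittle_diag n f i))"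
proof -
  let ?d = "whittle_diag n f" and ?y = "\<lambda>i. fourier_design X n i \<bullet> h"
    and ?u = "\<lambda>i. fourier_data n z i - fourier_design X n i \<bullet> \<theta>"
  \<comment> \<open>The log-likelihood is exactly quadratic in the parameter, so its expansion at
    \<open>\<theta>\<close> has no remainder; the normalizing factor does not involve
    \<open>\<theta>\<close>.\<close>
  have "(fourier_data n z i - fourier_design X n i \<bullet> (\<theta> + h))\<^sup>2 / ?d i
      = (?u i)\<^sup>2 / ?d i - 2 * (?u i * ?y i / ?d i) + (?y i)\<^sup>2 / ?d i" for i
    unfolding inner_add_right diff_diff_eq[symmetric]
    by (simp add: power2_diff diff_divide_distrib add_divide_distrib)
  then have "(\<Sum>i<n. (fourier_data n z i - fourier_design X n i \<bullet> (\<theta> + h))\<^sup>2 / ?d i)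
      = (\<Sum>i<n. (?u i)\<^sup>2 / ?d i) - 2 * (\<Sum>i<n. ?u i * ?y i / ?d i) + (\<Sum>i<n. (?y i)\<^sup>2 / ?d i)"
    by (simp only: sum.distrib sum_subtractf sum_distrib_left)
  then show ?thesis
    unfolding whittle_density_def by (simp add: exp_add[symmetric] algebra_simps)
qed

text \<open>The score is bounded per unit of \<open>norm h\<close>, and
  \<open>sqrt (a * real n)\<close> is the rate at which the design converts \<open>norm h\<close>
  into \<open>N h\<close>. In the quadratic term, the upper bound on \<open>f\<close> gives the
  upper estimate and the lower bound on \<open>f\<close> the lower one; \<open>4 * pi\<close> is the
  \<open>2 * pi\<close> of \<open>whittle_diag\<close> doubled by the \<open>1 / 2\<close> in the
  exponent.\<close>

lemma whittle_density_ratio_bounds: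
  fixes X :: "'r::finite design" and \<theta> :: "real ^ 'r"
  assumes f: "f \<in> spectral_class \<tau>0 \<tau>1" and "0 < \<tau>0" and n: "0 < n"
    and a: "0 < a" "\<And>x. a * real n * (norm x)\<^sup>2 \<le> (\<Sum>t=1..n. (X n t \<bullet> x)\<^sup>2)"
    and K: "score_bound X n \<theta> (1 / (2 * pi * \<tau>0)) (\<tau>1 / \<tau>0\<^sup>2) z \<le> K * sqrt (a * real n)" and "0 \<le> K"
  defines "N \<equiv> \<lambda>h. L2_set (\<lambda>t. X n t \<bullet> h) {1..n}"
  shows "whittle_density X n (\<theta> + h) f z \<le> whittle_density X n \<theta> f z * exp (K * N h - 1 / (4 * pi * \<tau>1) * (N h)\<^sup>2)"
    and "whittle_density X n \<theta> f z * exp (- K * N h - 1 / (4 * pi * \<tau>0) * (N h)\<^sup>2) \<le> whittle_density X n (\<theta> + h) f z"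
proof -
  let ?d = "whittle_diag n f" and ?y = "\<lambda>i. fourier_design X n i \<bullet> h"
  define A where "A = (\<Sum>i<n. (fourier_data n z i - fourier_design X n i \<bullet> \<theta>) * ?y i / ?d i)"
  define Q where "Q = (\<Sum>i<n. (?y i)\<^sup>2 / ?d i)"
  have d: "0 < 2 * pi * \<tau>0" "2 * pi * \<tau>0 \<le> ?d i" "?d i \<le> 2 * pi * \<tau>1" if "i < n" for i
    using whittle_diag_bounds[OF f \<open>0 < \<tau>0\<close> that] \<open>0 < \<tau>0\<close> by simp_all
  have d_pos: "0 < ?d i" if "i < n" for i using d[OF that] by linarith
  have N: "(N h)\<^sup>2 = (\<Sum>i<n. (?y i)\<^sup>2)"
    unfolding N_def L2_set_def sum_fourier_design_squares[OF n] by (simp add: sum_nonneg)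
  have A: "\<bar>A\<bar> \<le> K * N h"
  proof -
    have "\<bar>A\<bar> \<le> score_bound X n \<theta> (1 / (2 * pi * \<tau>0)) (\<tau>1 / \<tau>0\<^sup>2) z * norm h"
      unfolding A_def by (rule score_le_score_bound[OF f \<open>0 < \<tau>0\<close> n])
    also have "\<dots> \<le> K * sqrt (a * real n) * norm h" by (rule mult_right_mono[OF K]) simp
    also have "\<dots> = K * sqrt (a * real n * (norm h)\<^sup>2)"
      by (simp add: real_sqrt_mult)
    also have "\<dots> \<le> K * N h"
      unfolding N_def L2_set_def using a(2) \<open>0 \<le> K\<close> by (intro mult_left_mono real_sqrt_le_mono)
    finally show ?thesis .
  qed
  have Q_le: "Q \<le> (N h)\<^sup>2 / (2 * pi * \<tau>0)"
    unfolding N Q_def sum_divide_distrib 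
  proof (rule sum_mono)
    fix i assume "i \<in> {..<n}"
    then show "(?y i)\<^sup>2 / ?d i \<le> (?y i)\<^sup>2 / (2 * pi * \<tau>0)"
      using d[of i] d_pos[of i] \<open>0 < \<tau>0\<close> by (intro divide_left_mono mult_pos_pos) auto
  qed
  have Q_ge: "(N h)\<^sup>2 / (2 * pi * \<tau>1) \<le> Q"
    unfolding N Q_def sum_divide_distrib
  proof (rule sum_mono)
    fix i assume "i \<in> {..<n}"
    then show "(?y i)\<^sup>2 / (2 * pi * \<tau>1) \<le> (?y i)\<^sup>2 / ?d i"
      using d[of i] d_pos[of i] by (intro divide_left_mono mult_pos_pos[of _ "?d i"]) auto
  qed
  have trans: "whittle_density X n (\<theta> + h) f z = whittle_density X n \<theta> f z * exp (A - 1 / 2 * Q)"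
    unfolding A_def Q_def by (rule whittle_density_translate)
  have pos: "0 \<le> whittle_density X n \<theta> f z"
    by (rule less_imp_le, rule whittle_density_pos) (rule d_pos)
  have half: "1 / (4 * pi * \<tau>) * (N h)\<^sup>2 = 1 / 2 * ((N h)\<^sup>2 / (2 * pi * \<tau>))" for \<tau> by simp
  show "whittle_density X n (\<theta> + h) f z \<le> whittle_density X n \<theta> f z * exp (K * N h - 1 / (4 * pi * \<tau>1) * (N h)\<^sup>2)"
    unfolding trans half by (rule mult_left_mono[OF _ pos]) (use A Q_ge in simp)
  show "whittle_density X n \<theta> f z * exp (- K * N h - 1 / (4 * pi * \<tau>0) * (N h)\<^sup>2) \<le> whittle_density X n (\<theta> + h) f z"
    unfolding trans half by (rule mult_left_mono[OF _ pos]) (use A Q_le in simp)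
qed

section \<open>Tails of quasi-Gaussian integrals\<close>

lemma nn_integral_isotropic_gaussian:
  fixes m :: "'a::euclidean_space"
  assumes "0 < c"
  shows "(\<integral>\<^sup>+ x. ennreal (exp (- c * (norm (x - m))\<^sup>2)) \<partial>lborel) = ennreal (sqrt (pi / c) ^ DIM('a))"
proof -
  have "ennreal (exp (- c * (norm (x - m))\<^sup>2)) = (\<Prod>b\<in>Basis. ennreal (exp (- c * (x \<bullet> b - m \<bullet> b)\<^sup>2)))" for x :: 'a
  proof -
    have "(norm (x - m))\<^sup>2 = (\<Sum>b\<in>Basis. (x \<bullet> b - m \<bullet> b)\<^sup>2)"
      unfolding power2_norm_eq_inner by (subst euclidean_inner) (simp add: inner_diff_left power2_eq_square)
    then show ?thesis by (simp add: sum_distrib_left exp_sum prod_ennreal sum_negf[symmetric])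
  qed
  then have "(\<integral>\<^sup>+ x. ennreal (exp (- c * (norm (x - m))\<^sup>2)) \<partial>lborel)
      = (\<Prod>b\<in>(Basis :: 'a set). \<integral>\<^sup>+ x. ennreal (exp (- c * (x - m \<bullet> b)\<^sup>2)) \<partial>lborel)"
    by (simp only:) (rule nn_integral_lborel_prod, auto)
  also have "\<dots> = ennreal (sqrt (pi / c) ^ DIM('a))"
    using assms by (simp only: nn_integral_gaussian[OF assms]) (simp add: ennreal_power)
  finally show ?thesis .
qed

text \<open>
  Both integrals are of order \<open>\<nu> powr (- DIM('a) / 2)\<close>: the one on the left is compared with
  a Gaussian integral, the one on the right with the volume of a ball of radius \<open>1 / sqrt \<nu>\<close>.
\<close>

lemma nn_integral_tail_le:
  fixes g q N :: "'a::euclidean_space \<Rightarrow> real"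
  assumes [measurable]: "g \<in> borel_measurable borel" "q \<in> borel_measurable borel" "N \<in> borel_measurable borel"
    and g: "\<And>x. 0 \<le> g x" "\<And>x. g x \<le> C" "\<And>x. x \<in> ball m (1 / sqrt \<nu>) \<Longrightarrow> \<gamma> \<le> g x"
    and N: "\<And>h. 0 \<le> N h" "\<And>h. a * \<nu> * (norm h)\<^sup>2 \<le> (N h)\<^sup>2" "\<And>h. (N h)\<^sup>2 \<le> b * \<nu> * (norm h)\<^sup>2"
    and pos: "0 < \<nu>" "0 < a" "0 < b" "0 < c1" "0 < c2" "0 \<le> K" "0 < \<gamma>" "0 < p" "0 \<le> C"
    and q_le: "\<And>h. q (m + h) \<le> p * exp (K * N h - c1 * (N h)\<^sup>2)"
    and q_ge: "\<And>h. p * exp (- K * N h - c2 * (N h)\<^sup>2) \<le> q (m + h)"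
    and R: "0 \<le> R" "2 * K / c1 \<le> R"
  shows "(\<integral>\<^sup>+ x. ennreal (g x) * (ennreal (q x) * indicator {x. R \<le> N (x - m)} x) \<partial>lborel)
    \<le> ennreal (C * sqrt (4 * pi / (c1 * a)) ^ DIM('a)
          / (\<gamma> * exp (- K * sqrt b - c2 * b) * unit_ball_vol (real DIM('a))) * exp (- c1 / 4 * R\<^sup>2))
      * (\<integral>\<^sup>+ x. ennreal (g x) * ennreal (q x) \<partial>lborel)"
    (is "?lhs \<le> ennreal ?A * ?rhs")
proof -
  define r where "r = 1 / sqrt \<nu>"
  define G where "G = sqrt (4 * pi / (c1 * a)) ^ DIM('a)"
  define v where "v = unit_ball_vol (real DIM('a))"
  define \<beta> where "\<beta> = exp (- K * sqrt b - c2 * b)"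
  have v: "0 < v" unfolding v_def by (rule unit_ball_vol_pos) simp
  have r: "0 < r" "r\<^sup>2 = 1 / \<nu>" unfolding r_def using pos by (simp_all add: power_divide)
  have G: "0 \<le> G" unfolding G_def using pos by simp
  have q_nonneg: "0 \<le> q x" for x
  proof -
    have "0 \<le> p * exp (- K * N (x - m) - c2 * (N (x - m))\<^sup>2)" using pos by simp
    also have "\<dots> \<le> q x" using q_ge[of "x - m"] by simp
    finally show ?thesis .
  qed
  define \<kappa> where "\<kappa> = c1 * a * \<nu> / 4"
  have \<kappa>: "0 < \<kappa>" unfolding \<kappa>_def using pos by simp
  have upper: "g x * q x \<le> C * p * exp (- c1 / 4 * R\<^sup>2) * exp (- \<kappa> * (norm (x - m))\<^sup>2)" if "R \<le> N (x - m)" for x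
  proof -
    let ?s = "N (x - m)"
    have s: "0 \<le> ?s" using N by simp
    \<comment> \<open>From \<open>R\<close> on, the linear term consumes at most half of the
      quadratic one. The remaining half is split in two quarters: one becomes the factor
      \<open>exp (- c1 / 4 * R\<^sup>2)\<close>, the other an integrable Gaussian in
      \<open>x - m\<close>.\<close>
    have "K * ?s \<le> (c1 / 2 * ?s) * ?s"
    proof (rule mult_right_mono[OF _ s])
      have "2 * K / c1 \<le> ?s" using R(2) that by linarith
      then show "K \<le> c1 / 2 * ?s" using pos by (simp add: field_simps)
    qed
    then have 1: "K * ?s - c1 * ?s\<^sup>2 \<le> - c1 / 2 * ?s\<^sup>2" by (simp add: power2_eq_square)
    have 2: "c1 / 4 * R\<^sup>2 \<le> c1 / 4 * ?s\<^sup>2"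
      using that R(1) pos by (intro mult_left_mono power_mono) auto
    have 3: "\<kappa> * (norm (x - m))\<^sup>2 \<le> c1 / 4 * ?s\<^sup>2"
      unfolding \<kappa>_def using mult_left_mono[OF N(2)[of "x - m"], of "c1 / 4"] pos by (simp add: mult_ac)
    have "q x \<le> p * exp (K * ?s - c1 * ?s\<^sup>2)" using q_le[of "x - m"] by simp
    also have "\<dots> \<le> p * exp (- c1 / 4 * R\<^sup>2 + - \<kappa> * (norm (x - m))\<^sup>2)"
    proof -
      have "K * ?s - c1 * ?s\<^sup>2 \<le> - c1 / 4 * R\<^sup>2 + - \<kappa> * (norm (x - m))\<^sup>2"
        using 1 2 3 by linarith
      then show ?thesis using pos by simp
    qed
    finally have "q x \<le> p * exp (- c1 / 4 * R\<^sup>2) * exp (- \<kappa> * (norm (x - m))\<^sup>2)"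
      by (simp only: exp_add mult.assoc)
    then have "g x * q x \<le> C * (p * exp (- c1 / 4 * R\<^sup>2) * exp (- \<kappa> * (norm (x - m))\<^sup>2))"
      using g q_nonneg pos by (intro mult_mono) auto
    then show ?thesis by (simp add: mult.assoc)
  qed
  have "?lhs \<le> (\<integral>\<^sup>+ x. ennreal (C * p * exp (- c1 / 4 * R\<^sup>2)) * ennreal (exp (- \<kappa> * (norm (x - m))\<^sup>2)) \<partial>lborel)"
  proof (rule nn_integral_mono)
    fix x
    show "ennreal (g x) * (ennreal (q x) * indicator {x. R \<le> N (x - m)} x)
      \<le> ennreal (C * p * exp (- c1 / 4 * R\<^sup>2)) * ennreal (exp (- \<kappa> * (norm (x - m))\<^sup>2))"
      using upper[of x] g q_nonneg pos
      by (cases "R \<le> N (x - m)") (simp_all add: ennreal_mult[symmetric] ennreal_leI)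
  qed
  also have "\<dots> = ennreal (C * p * exp (- c1 / 4 * R\<^sup>2)) * ennreal (sqrt (pi / \<kappa>) ^ DIM('a))"
    by (subst nn_integral_cmult) (simp_all add: nn_integral_isotropic_gaussian[OF \<kappa>, simplified])
  also have "\<dots> = ennreal (C * p * exp (- c1 / 4 * R\<^sup>2) * sqrt (pi / \<kappa>) ^ DIM('a))"
    using pos \<kappa> by (simp add: ennreal_mult)
  also have "sqrt (pi / \<kappa>) ^ DIM('a) = G * r ^ DIM('a)"
  proof -
    have "pi / \<kappa> = 4 * pi / (c1 * a) * (1 / \<nu>)" unfolding \<kappa>_def by simp
    then have "sqrt (pi / \<kappa>) = sqrt (4 * pi / (c1 * a)) * r"
      unfolding r_def by (simp only: real_sqrt_mult real_sqrt_divide real_sqrt_one)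
    then show ?thesis unfolding G_def by (simp add: power_mult_distrib)
  qed
  finally have lhs: "?lhs \<le> ennreal (C * p * exp (- c1 / 4 * R\<^sup>2) * (G * r ^ DIM('a)))" .
  \<comment> \<open>On this ball \<open>N (x - m)\<close> is at most \<open>sqrt b\<close>, whatever
    \<open>\<nu>\<close> is, so \<open>q\<close> stays above the fixed fraction
    \<open>\<beta>\<close> of its scale \<open>p\<close>.\<close>
  have lower: "\<gamma> * (p * \<beta>) \<le> g x * q x" if "x \<in> ball m r" for x
  proof -
    let ?s = "N (x - m)"
    have "(norm (x - m))\<^sup>2 \<le> r\<^sup>2"
      using that by (intro power_mono) (auto simp: dist_norm norm_minus_commute)
    then have "b * \<nu> * (norm (x - m))\<^sup>2 \<le> b * \<nu> * r\<^sup>2"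
      using pos by (intro mult_left_mono) auto
    also have "b * \<nu> * r\<^sup>2 = b" unfolding r(2) using pos by simp
    finally have s2: "?s\<^sup>2 \<le> b" using N(3)[of "x - m"] by linarith
    then have s: "?s \<le> sqrt b" by (rule real_le_rsqrt)
    have "K * ?s \<le> K * sqrt b" "c2 * ?s\<^sup>2 \<le> c2 * b"
      using s s2 pos by (auto intro!: mult_left_mono)
    then have "\<beta> \<le> exp (- K * ?s - c2 * ?s\<^sup>2)" unfolding \<beta>_def by simp
    then have "p * \<beta> \<le> p * exp (- K * ?s - c2 * ?s\<^sup>2)" using pos by (intro mult_left_mono) auto
    also have "\<dots> \<le> q x" using q_ge[of "x - m"] by simp
    finally show ?thesis
      using g(3)[of x] that pos g(1) q_nonneg unfolding r_def \<beta>_def by (intro mult_mono) auto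
  qed
  have "ennreal (\<gamma> * (p * \<beta>) * (v * r ^ DIM('a))) = ennreal (\<gamma> * (p * \<beta>)) * emeasure lborel (ball m r)"
    using pos r v unfolding \<beta>_def v_def by (simp add: emeasure_ball ennreal_mult)
  also have "\<dots> = (\<integral>\<^sup>+ x. ennreal (\<gamma> * (p * \<beta>)) * indicator (ball m r) x \<partial>lborel)"
    by (simp add: nn_integral_cmult_indicator)
  also have "\<dots> \<le> ?rhs"
    using lower g q_nonneg
    by (intro nn_integral_mono) (auto simp: ennreal_mult[symmetric] ennreal_leI split: split_indicator)
  finally have rhs: "ennreal (\<gamma> * (p * \<beta>) * (v * r ^ DIM('a))) \<le> ?rhs" .
  have \<beta>: "0 < \<beta>" unfolding \<beta>_def by simp
  have A: "?A = C * G / (\<gamma> * \<beta> * v) * exp (- c1 / 4 * R\<^sup>2)"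
    unfolding G_def \<beta>_def v_def by simp
  \<comment> \<open>The powers of \<open>r\<close> and the scale \<open>p\<close> cancel, so the
    final constant depends neither on \<open>\<nu>\<close> nor on the size of the
    likelihood.\<close>
  have "C * p * exp (- c1 / 4 * R\<^sup>2) * (G * r ^ DIM('a)) = ?A * (\<gamma> * (p * \<beta>) * (v * r ^ DIM('a)))"
    unfolding A using pos \<beta> v by (simp add: field_simps)
  then have "?lhs \<le> ennreal ?A * ennreal (\<gamma> * (p * \<beta>) * (v * r ^ DIM('a)))"
    using lhs pos \<beta> v r G by (subst ennreal_mult[symmetric]) (auto simp: A)
  also have "\<dots> \<le> ennreal ?A * ?rhs"
    by (intro mult_left_mono rhs) simp
  finally show ?thesis .
qed

section \<open>Pseudo-posteriors\<close>

text \<open>\<open>measure_of\<close> assigns \<open>0\<close> whenever its data do not form a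
  measure or the set is not measurable, so the inequality holds for arbitrary \<open>f\<close> and
  \<open>A\<close>.\<close>

lemma emeasure_density_le: "emeasure (density M f) A \<le> (\<integral>\<^sup>+ x. f x * indicator A x \<partial>M)"
  unfolding density_def emeasure_measure_of_conv by simp

lemma emeasure_distr_le: "emeasure (distr M N f) A \<le> emeasure M (space M)"
  unfolding distr_def emeasure_measure_of_conv by (simp add: emeasure_space)

text \<open>\<open>T\<close> is arbitrary, so the argument uses simple functions: one that lies
  below the integrand and has positive integral stays below it after multiplication by
  \<open>\<top>\<close>.\<close>

lemma nn_integral_top_indicator: "(\<integral>\<^sup>+ x. \<top> * indicator T x \<partial>M) \<in> {0, \<top> :: ennreal}"
proof (cases "(\<integral>\<^sup>+ x. \<top> * indicator T x \<partial>M) = 0")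
  case False
  then have "0 < (\<integral>\<^sup>+ x. \<top> * indicator T x \<partial>M)" by (simp add: zero_less_iff_neq_zero)
  then obtain s where s: "simple_function M s" "s \<le> (\<lambda>x. \<top> * indicator T x)" "0 < integral\<^sup>S M s"
    unfolding nn_integral_def less_SUP_iff by auto
  have "(\<integral>\<^sup>+ x. \<top> * s x \<partial>M) \<le> (\<integral>\<^sup>+ x. \<top> * indicator T x \<partial>M)"
  proof (rule nn_integral_mono)
    fix x
    have "s x \<le> \<top> * indicator T x" using s(2) by (simp add: le_fun_def)
    then show "\<top> * s x \<le> \<top> * indicator T x" by (auto split: split_indicator)
  qed
  moreover have "(\<integral>\<^sup>+ x. \<top> * s x \<partial>M) = \<top> * integral\<^sup>S M s"
    using s(1) by (subst nn_integral_cmult) (auto simp: nn_integral_eq_simple_integral borel_measurable_simple_function)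
  moreover have "\<top> * integral\<^sup>S M s = \<top>" using s(3) by (simp add: ennreal_top_mult)
  ultimately show ?thesis by (simp add: top_unique)
qed simp

text \<open>Division by zero in \<open>ennreal\<close> yields the density \<open>\<top>\<close> on
  \<open>A\<close> and \<open>0\<close> elsewhere.\<close>

lemma emeasure_uniform_measure_null:
  assumes "emeasure P A = 0"
  shows "emeasure (uniform_measure P A) S \<in> {0, \<top>}"
proof -
  have "indicator A x / (0 :: ennreal) * indicator S x = \<top> * indicator (A \<inter> S) x" for x
    by (auto split: split_indicator)
  then show ?thesis
    using nn_integral_top_indicator[of P "A \<inter> S"]
    unfolding uniform_measure_def density_def emeasure_measure_of_conv assms by simp
qed

text \<open>The inner integral of an indicator is the measure of a section, hence
  \<open>\<top>\<close> times an indicator, and so the outer integral is again \<open>0\<close> or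
  \<open>\<top>\<close>.\<close>

lemma emeasure_pair_measure_zero_top:
  assumes "\<And>S. emeasure P S \<in> {0, \<top>}"
  shows "emeasure (Q \<Otimes>\<^sub>M P) X \<in> {0, \<top>}"
proof (cases "X \<in> sets (Q \<Otimes>\<^sub>M P)")
  case True
  have "(\<integral>\<^sup>+ x. (\<integral>\<^sup>+ y. indicator X (x, y) \<partial>P) \<partial>Q) \<in> {0, \<top>}"
  proof -
    define T where "T = {x. emeasure P (Pair x -` X) \<noteq> 0}"
    have "(\<integral>\<^sup>+ y. indicator X (x, y) \<partial>P) = \<top> * indicator T x" for x
    proof -
      have "(\<integral>\<^sup>+ y. indicator X (x, y) \<partial>P) = (\<integral>\<^sup>+ y. indicator (Pair x -` X) y \<partial>P)"
        by (intro nn_integral_cong) (auto split: split_indicator)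
      also have "\<dots> = emeasure P (Pair x -` X)"
        by (rule nn_integral_indicator) (rule sets_Pair1[OF True])
      finally show ?thesis
        using assms[of "Pair x -` X"] by (auto simp: T_def split: split_indicator)
    qed
    then show ?thesis using nn_integral_top_indicator[of Q T] by simp
  qed
  then show ?thesis
    unfolding pair_measure_def emeasure_measure_of_conv by simp
qed (simp add: emeasure_notin_sets)

text \<open>An infinite normalizer makes the density zero. With a finite one, Markov's inequality
  shows that the sets where \<open>p\<close> is at least \<open>1 / n\<close> have finite measure,
  hence measure \<open>0\<close>, so that \<open>p\<close> is almost everywhere at most
  \<open>0\<close>.\<close>

lemma emeasure_density_zero_top:
  assumes \<mu>: "\<And>S. emeasure \<mu> S \<in> {0, \<top>}"
    and p[measurable]: "p \<in> borel_measurable \<mu>"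
  shows "emeasure (density \<mu> (\<lambda>x. ennreal (p x) / (\<integral>\<^sup>+ x. ennreal (p x) \<partial>\<mu>))) S = 0"
proof (cases "(\<integral>\<^sup>+ x. ennreal (p x) \<partial>\<mu>) = \<top>")
  case True
  then show ?thesis
    using emeasure_density_le[of \<mu> "\<lambda>_. 0" S] by simp
next
  case False
  define A where "A n = {x \<in> space \<mu>. 1 \<le> ennreal (real n) * ennreal (p x)}" for n :: nat
  have A: "A n \<in> null_sets \<mu>" for n
  proof -
    have "emeasure \<mu> (A n) \<le> ennreal (real n) * (\<integral>\<^sup>+ x. ennreal (p x) * indicator (space \<mu>) x \<partial>\<mu>)"
      unfolding A_def by (rule nn_integral_Markov_inequality) auto
    also have "\<dots> = ennreal (real n) * (\<integral>\<^sup>+ x. ennreal (p x) \<partial>\<mu>)"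
      by (auto intro!: arg_cong2[where f = "(*)"] nn_integral_cong)
    also have "\<dots> < \<top>" using False by (simp add: ennreal_mult_less_top less_top)
    finally have "emeasure \<mu> (A n) = 0" using \<mu>[of "A n"] by auto
    moreover have "A n \<in> sets \<mu>" unfolding A_def by measurable
    ultimately show ?thesis by auto
  qed
  have "{x \<in> space \<mu>. 0 < p x} \<subseteq> (\<Union>n. A n)"
  proof
    fix x assume x: "x \<in> {x \<in> space \<mu>. 0 < p x}"
    obtain n :: nat where "1 / p x < real n" using reals_Archimedean2 by blast
    then have "1 \<le> real n * p x" using x by (simp add: field_simps)
    then have "x \<in> A n" unfolding A_def using x
      by (simp add: ennreal_mult[symmetric] less_imp_le)
    then show "x \<in> (\<Union>n. A n)" by blast
  qed
  moreover have "(\<Union>n. A n) \<in> null_sets \<mu>" using A by (rule null_sets_UN)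
  ultimately have "AE x in \<mu>. p x \<le> 0"
    by (intro AE_I'[of "\<Union>n. A n"]) (auto simp: not_le)
  then have "(\<integral>\<^sup>+ x. ennreal (p x) / (\<integral>\<^sup>+ x. ennreal (p x) \<partial>\<mu>) * indicator S x \<partial>\<mu>) = (\<integral>\<^sup>+ x. 0 \<partial>\<mu>)"
    by (intro nn_integral_cong_AE) (auto elim!: eventually_mono simp: ennreal_neg)
  then show ?thesis
    using emeasure_density_le[of \<mu> "\<lambda>x. ennreal (p x) / (\<integral>\<^sup>+ x. ennreal (p x) \<partial>\<mu>)" S] by simp
qed

text \<open>
  Measurability of \<open>A\<close> is not assumed. If \<open>A\<close> is not measurable or is a null set, the conditional
  measure takes no values other than \<open>0\<close> and \<open>\<top>\<close>, and the normalized density is the zero measure.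
\<close>

lemma measure_pseudo_posterior_le:
  assumes Q: "prob_space Q" and P: "emeasure P (space P) \<noteq> \<top>"
    and p[measurable]: "p \<in> borel_measurable (Q \<Otimes>\<^sub>M P)"
    and B[measurable]: "B \<in> sets Q" and "0 \<le> \<delta>"
    and bound: "\<And>f. f \<in> A \<Longrightarrow> (\<integral>\<^sup>+ \<theta>. ennreal (p (\<theta>, f)) * indicator B \<theta> \<partial>Q) \<le> ennreal \<delta> * (\<integral>\<^sup>+ \<theta>. ennreal (p (\<theta>, f)) \<partial>Q)"
  defines "\<mu> \<equiv> Q \<Otimes>\<^sub>M uniform_measure P A"
  shows "measure (density \<mu> (\<lambda>x. ennreal (p x) / (\<integral>\<^sup>+ x. ennreal (p x) \<partial>\<mu>))) (B \<times> H) \<le> \<delta>"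
proof (cases "emeasure P A = 0")
  case True
  have [measurable_cong]: "sets \<mu> = sets (Q \<Otimes>\<^sub>M P)"
    unfolding \<mu>_def by (rule sets_pair_measure_cong) simp_all
  have "emeasure (density \<mu> (\<lambda>x. ennreal (p x) / (\<integral>\<^sup>+ x. ennreal (p x) \<partial>\<mu>))) (B \<times> H) = 0"
  proof (rule emeasure_density_zero_top)
    show "emeasure \<mu> S \<in> {0, \<top>}" for S
      unfolding \<mu>_def by (rule emeasure_pair_measure_zero_top) (rule emeasure_uniform_measure_null[OF True])
  qed measurable
  then show ?thesis using \<open>0 \<le> \<delta>\<close> by (simp add: measure_def)
next
  case False
  define PA where "PA = uniform_measure P A"
  have [measurable_cong]: "sets PA = sets P" unfolding PA_def by simp
  have [measurable]: "A \<in> sets P" by (rule emeasure_neq_0_sets[OF False])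
  have "emeasure P A \<noteq> \<top>"
    using P emeasure_space[of P A] by (auto simp: top_unique)
  then interpret PA: prob_space PA
    unfolding PA_def using False by (intro prob_space_uniform_measure) auto
  interpret Q: prob_space Q by (rule Q)
  interpret pair_sigma_finite Q PA ..
  have AE_A: "AE f in PA. f \<in> A"
    unfolding PA_def by (rule AE_uniform_measureI) auto
  have [measurable]: "p \<in> borel_measurable (Q \<Otimes>\<^sub>M PA)" by measurable
  define I where "I = (\<integral>\<^sup>+ x. ennreal (p x) \<partial>(Q \<Otimes>\<^sub>M PA))"
  have num: "(\<integral>\<^sup>+ x. ennreal (p x) * indicator B (fst x) \<partial>(Q \<Otimes>\<^sub>M PA)) \<le> ennreal \<delta> * I"
  proof -
    have "(\<integral>\<^sup>+ x. ennreal (p x) * indicator B (fst x) \<partial>(Q \<Otimes>\<^sub>M PA))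
        = (\<integral>\<^sup>+ f. (\<integral>\<^sup>+ \<theta>. ennreal (p (\<theta>, f)) * indicator B \<theta> \<partial>Q) \<partial>PA)"
      by (subst nn_integral_snd[symmetric]) (simp_all add: split_beta)
    also have "\<dots> \<le> (\<integral>\<^sup>+ f. ennreal \<delta> * (\<integral>\<^sup>+ \<theta>. ennreal (p (\<theta>, f)) \<partial>Q) \<partial>PA)"
      using AE_A by (intro nn_integral_mono_AE) (auto elim!: eventually_mono dest: bound)
    also have "\<dots> = ennreal \<delta> * I"
      unfolding I_def by (subst nn_integral_cmult) (simp_all add: nn_integral_snd[symmetric])
    finally show ?thesis .
  qed
  have "emeasure (density (Q \<Otimes>\<^sub>M PA) (\<lambda>x. ennreal (p x) / I)) (B \<times> H)
      \<le> (\<integral>\<^sup>+ x. ennreal (p x) / I * indicator (B \<times> H) x \<partial>(Q \<Otimes>\<^sub>M PA))"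
    by (rule emeasure_density_le)
  \<comment> \<open>Enlarging \<open>B \<times> H\<close> to all pairs with first component in
    \<open>B\<close> gives a measurable integrand whatever \<open>H\<close> is.\<close>
  also have "\<dots> \<le> (\<integral>\<^sup>+ x. ennreal (p x) * indicator B (fst x) / I \<partial>(Q \<Otimes>\<^sub>M PA))"
    by (intro nn_integral_mono) (auto split: split_indicator)
  also have "\<dots> = (\<integral>\<^sup>+ x. ennreal (p x) * indicator B (fst x) \<partial>(Q \<Otimes>\<^sub>M PA)) / I"
    by (rule nn_integral_divide) measurable
  also have "\<dots> \<le> ennreal \<delta> * I / I" by (rule divide_right_mono_ennreal[OF num])
  also have "\<dots> \<le> ennreal \<delta>"
  \<comment> \<open>In \<open>ennreal\<close> both \<open>0 / 0\<close> and
    \<open>\<top> / \<top>\<close> are \<open>0\<close>, so degenerate normalizers satisfy the bound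
    as well.\<close>
  proof (cases "I = 0 \<or> I = \<top>")
    case True
    then show ?thesis by (auto simp: ennreal_divide_top)
  next
    case False
    then show ?thesis by (simp add: ennreal_times_divide[symmetric] ennreal_divide_self less_top)
  qed
  finally show ?thesis
    unfolding \<mu>_def PA_def[symmetric] I_def[symmetric] measure_def
    using \<open>0 \<le> \<delta>\<close> by (simp add: enn2real_leI)
qed

section \<open>The Whittle pseudo-posterior\<close>

lemma borel_measurable_whittle_density_pair:
  assumes "sets Q = sets borel" "sets P = sets cont_space"
  shows "(\<lambda>(\<theta>, f). whittle_density X n \<theta> f z) \<in> borel_measurable (Q \<Otimes>\<^sub>M P)"
proof -
  have [measurable_cong]: "sets Q = sets borel" "sets P = sets cont_space" by (fact assms)+
  \<comment> \<open>The likelihood depends on \<open>f\<close> through finitely many point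
    evaluations, which are measurable on \<open>cont_space\<close>.\<close>
  have point[measurable]: "(\<lambda>x. whittle_diag n (snd x) i) \<in> borel_measurable (Q \<Otimes>\<^sub>M P)" if "i \<in> {..<n}" for i
  proof -
    have "(\<lambda>f. f (2 * pi * real ((i + 1) div 2) / real n)) \<in> borel_measurable cont_space"
      unfolding cont_space_def using that
      by (intro measurable_restrict_space1 measurable_component_singleton fourier_frequency_in_interval) simp
    then show ?thesis unfolding whittle_diag_def by measurable
  qed
  show ?thesis unfolding whittle_density_def split_beta by measurable
qed

text \<open>For each \<open>f\<close> the tail estimate applies with
  \<open>c1 = 1 / (4 * pi * \<tau>1)\<close> and \<open>c2 = 1 / (4 * pi * \<tau>0)\<close>, and its
  factor is free of \<open>f\<close>, as the mixture over \<open>f\<close> requires.\<close>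

lemma measure_whittle_posterior_le:
  fixes X :: "'r::finite design" and \<theta>0 :: "real ^ 'r" and P\<theta> :: "(real ^ 'r) measure"
  assumes P: "prob_space P\<theta>" "P\<theta> = density lborel (\<lambda>\<theta>. ennreal (g \<theta>))"
    and g[measurable]: "g \<in> borel_measurable borel" and g_bounds: "\<And>\<theta>. 0 \<le> g \<theta>" "\<And>\<theta>. g \<theta> \<le> C"
      "\<And>\<theta>. \<theta> \<in> ball \<theta>0 (1 / sqrt (real n)) \<Longrightarrow> \<gamma> \<le> g \<theta>"
    and prior: "emeasure Pf (space Pf) \<noteq> \<top>" "sets Pf = sets cont_space"
    and X: "\<And>x. a * real n * (norm x)\<^sup>2 \<le> (\<Sum>t=1..n. (X n t \<bullet> x)\<^sup>2)"
      "\<And>x. (\<Sum>t=1..n. (X n t \<bullet> x)\<^sup>2) \<le> b * real n * (norm x)\<^sup>2"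
    and pos: "0 < n" "0 < a" "0 < b" "0 < \<tau>0" "0 < \<tau>1" "0 < \<gamma>" "0 \<le> C" "0 \<le> K"
    and score: "score_bound X n \<theta>0 (1 / (2 * pi * \<tau>0)) (\<tau>1 / \<tau>0\<^sup>2) z \<le> K * sqrt (a * real n)"
    and R: "0 \<le> R" "2 * K / (1 / (4 * pi * \<tau>1)) \<le> R"
  shows "measure (whittle_posterior X P\<theta> (uniform_measure Pf (spectral_class \<tau>0 \<tau>1)) n z)
      ({\<theta>. L2_set (\<lambda>t. X n t \<bullet> (\<theta> - \<theta>0)) {1..n} \<ge> R} \<times> H)
    \<le> C * sqrt (4 * pi / (1 / (4 * pi * \<tau>1) * a)) ^ CARD('r)
          / (\<gamma> * exp (- K * sqrt b - 1 / (4 * pi * \<tau>0) * b) * unit_ball_vol (real CARD('r)))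
        * exp (- (1 / (4 * pi * \<tau>1)) / 4 * R\<^sup>2)"
    (is "measure _ (?B \<times> H) \<le> ?\<delta>")
proof -
  define p where "p = (\<lambda>(\<theta>, f). whittle_density X n \<theta> f z)"
  define N where "N h = L2_set (\<lambda>t. X n t \<bullet> h) {1..n}" for h
  have N_meas[measurable]: "N \<in> borel_measurable borel" unfolding N_def L2_set_def by measurable
  have [measurable_cong]: "sets P\<theta> = sets borel" unfolding P(2) by simp
  have N_sq: "(N h)\<^sup>2 = (\<Sum>t=1..n. (X n t \<bullet> h)\<^sup>2)" for h
    unfolding N_def L2_set_def by (simp add: sum_nonneg)
  have B_eq: "?B = {\<theta>. R \<le> N (\<theta> - \<theta>0)}" unfolding N_def ..
  have "measure (density (P\<theta> \<Otimes>\<^sub>M uniform_measure Pf (spectral_class \<tau>0 \<tau>1))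
      (\<lambda>x. ennreal (p x) / (\<integral>\<^sup>+ x. ennreal (p x) \<partial>(P\<theta> \<Otimes>\<^sub>M uniform_measure Pf (spectral_class \<tau>0 \<tau>1))))) (?B \<times> H) \<le> ?\<delta>"
  proof (rule measure_pseudo_posterior_le[OF P(1) prior(1)])
    show "p \<in> borel_measurable (P\<theta> \<Otimes>\<^sub>M Pf)"
      unfolding p_def by (rule borel_measurable_whittle_density_pair) (simp_all add: P(2) prior(2))
    show "?B \<in> sets P\<theta>"
      unfolding B_eq P(2) sets_density sets_lborel by measurable
    have "0 \<le> unit_ball_vol (real CARD('r))" by simp
    then show "0 \<le> ?\<delta>" using pos by (intro mult_nonneg_nonneg divide_nonneg_nonneg) auto
    fix f assume f: "f \<in> spectral_class \<tau>0 \<tau>1"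
    define q where "q \<theta> = whittle_density X n \<theta> f z" for \<theta>
    have [measurable]: "q \<in> borel_measurable borel" unfolding q_def whittle_density_def by measurable
    have d: "0 < whittle_diag n f i" if "i < n" for i
      by (rule less_le_trans[OF _ whittle_diag_bounds(1)[OF f \<open>0 < \<tau>0\<close> that]]) (use \<open>0 < \<tau>0\<close> in simp)
    have "(\<integral>\<^sup>+ x. ennreal (g x) * (ennreal (q x) * indicator {x. R \<le> N (x - \<theta>0)} x) \<partial>lborel)
      \<le> ennreal (C * sqrt (4 * pi / (1 / (4 * pi * \<tau>1) * a)) ^ DIM(real ^ 'r)
          / (\<gamma> * exp (- K * sqrt b - 1 / (4 * pi * \<tau>0) * b) * unit_ball_vol (real DIM(real ^ 'r)))
        * exp (- (1 / (4 * pi * \<tau>1)) / 4 * R\<^sup>2))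
      * (\<integral>\<^sup>+ x. ennreal (g x) * ennreal (q x) \<partial>lborel)"
    proof (rule nn_integral_tail_le[where \<nu> = "real n" and p = "q \<theta>0"])
      show "0 \<le> N h" for h unfolding N_def by simp
      show "a * real n * (norm h)\<^sup>2 \<le> (N h)\<^sup>2" "(N h)\<^sup>2 \<le> b * real n * (norm h)\<^sup>2" for h
        unfolding N_sq by (rule X)+
      show "0 < q \<theta>0" unfolding q_def by (rule whittle_density_pos) (rule d)
      show "q (\<theta>0 + h) \<le> q \<theta>0 * exp (K * N h - 1 / (4 * pi * \<tau>1) * (N h)\<^sup>2)"
        and "q \<theta>0 * exp (- K * N h - 1 / (4 * pi * \<tau>0) * (N h)\<^sup>2) \<le> q (\<theta>0 + h)" for h
        unfolding q_def N_def
        by (rule whittle_density_ratio_bounds[OF f pos(4) pos(1) pos(2) X(1) score pos(8)])+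
    qed (use g_bounds pos R in auto)
    then show "(\<integral>\<^sup>+ \<theta>. ennreal (p (\<theta>, f)) * indicator ?B \<theta> \<partial>P\<theta>) \<le> ennreal ?\<delta> * (\<integral>\<^sup>+ \<theta>. ennreal (p (\<theta>, f)) \<partial>P\<theta>)"
      unfolding B_eq P(2) p_def prod.case q_def[symmetric]
      by (simp add: nn_integral_density)
  qed
  then show ?thesis
    unfolding whittle_posterior_def p_def by (simp add: case_prod_unfold)
qed

section \<open>Contraction in probability\<close>

theorem lemma8:
  fixes X :: "'r::finite design" and \<theta>0 :: "real ^ 'r"
    and W :: "'w measure" and e :: "int \<Rightarrow> 'w \<Rightarrow> real" and Z :: "nat \<Rightarrow> 'w \<Rightarrow> nat \<Rightarrow> real"
    and f0 :: "real \<Rightarrow> real" and \<tau>0 \<tau>1 :: real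
    and P\<theta> :: "(real ^ 'r) measure" and g :: "real ^ 'r \<Rightarrow> real"
    and \<nu> C :: real and U :: "(real ^ 'r) set"
    and \<Omega> :: "'o measure" and K :: "'o \<Rightarrow> nat" and \<Phi> :: "'o \<Rightarrow> real measure"
    and p :: "nat pmf" and \<alpha> \<beta> :: "real \<Rightarrow> real"
    and g0 g1 A1 A2 \<kappa>1 \<kappa>2 :: real and M :: "nat \<Rightarrow> real"
  assumes model: "\<And>n w t. w \<in> space W \<Longrightarrow> t \<in> {1..n} \<Longrightarrow> Z n w t = X n t \<bullet> \<theta>0 + e (int t) w"
    and noise: "gaussian_series_with_spectral_density W e f0"
    and D: "regular_design X"
    and F: "regular_spectral_density f0"
    and tau: "0 < \<tau>0" "\<tau>0 < (INF \<omega>\<in>{0..2*pi}. f0 \<omega>)" "(SUP \<omega>\<in>{0..2*pi}. f0 \<omega>) < \<tau>1"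
    and P_prob: "prob_space P\<theta>"
    and P_density: "P\<theta> = density lborel (\<lambda>\<theta>. ennreal (g \<theta>))"
      "g \<in> borel_measurable borel" "\<And>\<theta>. 0 \<le> g \<theta>"
    and P_moment: "0 < \<nu>" "integrable P\<theta> (\<lambda>\<theta>. norm \<theta> powr \<nu>)"
    and P_bound: "0 < C" "\<And>\<theta>. g \<theta> \<le> C"
    and P_cont: "open U" "\<theta>0 \<in> U" "continuous_on U g" "\<And>\<theta>. \<theta> \<in> U \<Longrightarrow> 0 < g \<theta>"
    and prior: "bernstein_gamma_model \<Omega> K \<Phi> p \<alpha> \<beta>"
    and G: "0 < g0" "0 < g1"
      "AE x in lebesgue_on {0..pi}. g0 \<le> \<alpha> x \<and> \<alpha> x \<le> g1 \<and> g0 \<le> \<beta> x \<and> \<beta> x \<le> g1"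
    and K: "0 < A1" "0 < A2" "0 < \<kappa>1" "0 < \<kappa>2"
      "\<And>j. 1 \<le> j \<Longrightarrow> A1 * exp (- \<kappa>1 * real j * ln (real j)) \<le> pmf p j"
      "\<And>j. 1 \<le> j \<Longrightarrow> pmf p j \<le> A2 * exp (- \<kappa>2 * real j)"
    and M: "\<And>n. 0 < M n" "filterlim M at_top sequentially"
  shows "\<forall>\<epsilon>>0. (\<lambda>n. measure (whittle_measure X n \<theta>0 f0)
      {z \<in> space (whittle_measure X n \<theta>0 f0).
         measure (whittle_posterior X P\<theta>
             (uniform_measure (bernstein_gamma_prior \<Omega> K \<Phi>) (spectral_class \<tau>0 \<tau>1)) n z)
           ({\<theta>. L2_set (\<lambda>t. X n t \<bullet> (\<theta> - \<theta>0)) {1..n} \<ge> M n} \<times>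
            {f \<in> spectral_class \<tau>0 \<tau>1. sup_norm (\<lambda>x. f x - f0 x) \<le> 1 / ln (real n)})
         > \<epsilon>}) \<longlonglongrightarrow> 0"
proof (intro allI impI)
  fix \<epsilon> :: real assume \<epsilon>: "0 < \<epsilon>"
  define Pf where "Pf = bernstein_gamma_prior \<Omega> K \<Phi>"
  define PW where "PW n = whittle_measure X n \<theta>0 f0" for n
  define post where "post n z = measure (whittle_posterior X P\<theta> (uniform_measure Pf (spectral_class \<tau>0 \<tau>1)) n z)
      ({\<theta>. L2_set (\<lambda>t. X n t \<bullet> (\<theta> - \<theta>0)) {1..n} \<ge> M n} \<times>
       {f \<in> spectral_class \<tau>0 \<tau>1. sup_norm (\<lambda>x. f x - f0 x) \<le> 1 / ln (real n)})" for n z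
  interpret \<Omega>: prob_space \<Omega>
    using prior by (simp add: bernstein_gamma_model_def gamma_process_def completely_random_measure_def)
  \<comment> \<open>This bound on the total mass holds without measurability of the mixture
    map.\<close>
  have Pf_finite: "emeasure Pf (space Pf) \<noteq> \<top>"
    using emeasure_distr_le[of \<Omega> cont_space "\<lambda>w. bernstein_mixture (\<Phi> w) (K w)" "space Pf"]
    unfolding Pf_def bernstein_gamma_prior_def \<Omega>.emeasure_space_1 by (auto simp: top_unique)
  have Pf_sets: "sets Pf = sets cont_space" unfolding Pf_def bernstein_gamma_prior_def by simp
  have f0: "\<tau>0 < f0 \<omega>" "f0 \<omega> < \<tau>1" if "\<omega> \<in> {0..2*pi}" for \<omega>
  proof -
    obtain c c' where "\<forall>\<omega>\<in>{0..2*pi}. c \<le> f0 \<omega> \<and> f0 \<omega> \<le> c'"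
      using F unfolding regular_spectral_density_def by blast
    then have "bdd_below (f0 ` {0..2*pi})" "bdd_above (f0 ` {0..2*pi})"
      by (auto simp: bdd_below_def bdd_above_def)
    from cINF_lower[OF this(1) that] cSUP_upper[OF that this(2)]
    show "\<tau>0 < f0 \<omega>" "f0 \<omega> < \<tau>1" using tau by linarith+
  qed
  have "0 < \<tau>1" using f0[of 0] tau(1) by simp
  have d0: "0 < whittle_diag n f0 i \<and> whittle_diag n f0 i \<le> 2 * pi * \<tau>1" if "i < n" for n i
  proof -
    have "2 * pi * real ((i + 1) div 2) / real n \<in> {0..2*pi}"
      by (rule subsetD[OF _ fourier_frequency_in_interval[OF that]]) auto
    from f0[OF this] show ?thesis unfolding whittle_diag_def using tau(1) by simp
  qed
  obtain a b where a: "0 < a" and b: "0 < b" and X: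
    "\<forall>\<^sub>F n in sequentially. \<forall>x. a * real n * (norm x)\<^sup>2 \<le> (\<Sum>t=1..n. (X n t \<bullet> x)\<^sup>2) \<and>
       (\<Sum>t=1..n. (X n t \<bullet> x)\<^sup>2) \<le> b * real n * (norm x)\<^sup>2"
    using regular_design_norm_bounds[OF D] .
  \<comment> \<open>By continuity, half of \<open>g \<theta>0\<close> bounds \<open>g\<close> from
    below on a fixed ball, which eventually contains the ball of radius
    \<open>1 / sqrt n\<close>.\<close>
  define \<gamma> where "\<gamma> = g \<theta>0 / 2"
  have \<gamma>: "0 < \<gamma>" unfolding \<gamma>_def using P_cont(2,4) by simp
  obtain \<rho> where \<rho>: "0 < \<rho>" "\<And>\<theta>. dist \<theta> \<theta>0 < \<rho> \<Longrightarrow> \<gamma> < g \<theta>"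
  proof -
    have "isCont g \<theta>0" using P_cont(1-3) continuous_on_eq_continuous_at by blast
    then have "(g \<longlongrightarrow> g \<theta>0) (nhds \<theta>0)"
      unfolding isCont_def tendsto_at_iff_tendsto_nhds .
    then have "\<forall>\<^sub>F \<theta> in nhds \<theta>0. \<gamma> < g \<theta>"
      by (rule order_tendstoD(1)) (use \<gamma> in \<open>simp add: \<gamma>_def\<close>)
    then show thesis using that unfolding eventually_nhds_metric by blast
  qed
  define w l where "w = 1 / (2 * pi * \<tau>0)" and "l = \<tau>1 / \<tau>0\<^sup>2"
  have wl: "0 \<le> w" "0 \<le> l" unfolding w_def l_def using tau(1) \<open>0 < \<tau>1\<close> by simp_all
  \<comment> \<open>The moment bound for \<open>D = 2 * pi * \<tau>1\<close> and
    \<open>V = b * n\<close>, with \<open>sqrt n\<close> factored out.\<close>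
  define E where "E = real CARD('r) * ((w + l) * (2 * exp (1 / 2) * sqrt (2 * pi * \<tau>1 * b)))"
  have E: "0 \<le> E" unfolding E_def using wl \<open>0 < \<tau>1\<close> b by simp
  show "(\<lambda>n. measure (whittle_measure X n \<theta>0 f0) {z \<in> space (whittle_measure X n \<theta>0 f0).
      measure (whittle_posterior X P\<theta> (uniform_measure (bernstein_gamma_prior \<Omega> K \<Phi>) (spectral_class \<tau>0 \<tau>1)) n z)
        ({\<theta>. L2_set (\<lambda>t. X n t \<bullet> (\<theta> - \<theta>0)) {1..n} \<ge> M n} \<times>
         {f \<in> spectral_class \<tau>0 \<tau>1. sup_norm (\<lambda>x. f x - f0 x) \<le> 1 / ln (real n)}) > \<epsilon>}) \<longlonglongrightarrow> 0"
    unfolding Pf_def[symmetric] PW_def[symmetric] post_def[symmetric]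
  proof (rule tendstoI)
    fix \<eta> :: real assume \<eta>: "0 < \<eta>"
    \<comment> \<open>Markov's inequality at the level \<open>L * sqrt (a * n)\<close> gives
      \<open>E / (L * sqrt a)\<close>, in which \<open>n\<close> has cancelled. This
      \<open>L\<close> makes the quotient less than \<open>\<eta>\<close>; the added
      \<open>1\<close> keeps it positive even if \<open>E = 0\<close>.\<close>
    define L where "L = 2 * E / (\<eta> * sqrt a) + 1"
    have L: "0 < L" unfolding L_def using E \<eta> a by (intro add_nonneg_pos) auto
    define c where "c = 1 / (4 * pi * \<tau>1)"
    have c: "0 < c" unfolding c_def using \<open>0 < \<tau>1\<close> by simp
    define G where "G = C * sqrt (4 * pi / (c * a)) ^ CARD('r)
          / (\<gamma> * exp (- L * sqrt b - 1 / (4 * pi * \<tau>0) * b) * unit_ball_vol (real CARD('r)))"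
    have "(\<lambda>n. G * exp (- c / 4 * (M n)\<^sup>2)) \<longlonglongrightarrow> 0"
    proof (rule tendsto_mult_right_zero)
      have "filterlim (\<lambda>n. (M n)\<^sup>2) at_top sequentially"
        by (rule filterlim_pow_at_top[OF _ M(2)]) simp
      then have "filterlim (\<lambda>n. - c / 4 * (M n)\<^sup>2) at_bot sequentially"
        using c by (intro filterlim_tendsto_neg_mult_at_bot[OF tendsto_const]) auto
      then show "(\<lambda>n. exp (- c / 4 * (M n)\<^sup>2)) \<longlonglongrightarrow> 0"
        by (rule filterlim_compose[OF exp_at_bot])
    qed
    \<comment> \<open>\<open>G\<close> depends on \<open>\<eta>\<close> through \<open>L\<close>,
      but not on \<open>n\<close>, so the growth of \<open>M n\<close> suffices.\<close>
    then have ev_small: "\<forall>\<^sub>F n in sequentially. G * exp (- c / 4 * (M n)\<^sup>2) < \<epsilon>"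
      using \<epsilon> by (rule order_tendstoD(2))
    have ev_M: "\<forall>\<^sub>F n in sequentially. 2 * L / c \<le> M n"
      using M(2) by (simp add: filterlim_at_top)
    have "(\<lambda>n. 1 / sqrt (real n)) \<longlonglongrightarrow> 0"
      using tendsto_real_sqrt[OF lim_1_over_n] by (simp add: real_sqrt_divide)
    then have ev_\<rho>: "\<forall>\<^sub>F n in sequentially. 1 / sqrt (real n) < \<rho>"
      using \<rho>(1) by (rule order_tendstoD(2))
    show "\<forall>\<^sub>F n in sequentially. dist (measure (PW n) {z \<in> space (PW n). \<epsilon> < post n z}) 0 < \<eta>"
      using X ev_small ev_M ev_\<rho> eventually_gt_at_top[of 0]
    proof eventually_elim
      case (elim n)
      then have n: "0 < n" by simp
      define s where "s = L * sqrt (a * real n)"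
      have s: "0 < s" unfolding s_def using L a n by simp
      define A where "A = {z \<in> space (PW n). 1 \<le> ennreal (1 / s) * ennreal (score_bound X n \<theta>0 w l z)}"
      have [measurable_cong]: "sets (PW n) = sets (\<Pi>\<^sub>M t\<in>{1..n}. lborel)"
        unfolding PW_def whittle_measure_def by simp
      have A_sets: "A \<in> sets (PW n)" unfolding A_def by measurable
      have "emeasure (PW n) A \<le> ennreal (1 / s) * (\<integral>\<^sup>+ z. ennreal (score_bound X n \<theta>0 w l z) * indicator (space (PW n)) z \<partial>PW n)"
        unfolding A_def by (rule nn_integral_Markov_inequality) auto
      also have "(\<integral>\<^sup>+ z. ennreal (score_bound X n \<theta>0 w l z) * indicator (space (PW n)) z \<partial>PW n)
          = (\<integral>\<^sup>+ z. ennreal (score_bound X n \<theta>0 w l z) \<partial>PW n)"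
        by (intro nn_integral_cong) simp
      also have "\<dots> \<le> ennreal (real CARD('r) * ((w + l) * (2 * exp (1 / 2) * sqrt (2 * pi * \<tau>1 * (b * real n)))))"
        unfolding PW_def using elim(1) d0 wl \<open>0 < \<tau>1\<close> b n
        by (intro nn_integral_score_bound_whittle_measure) auto
      also have "real CARD('r) * ((w + l) * (2 * exp (1 / 2) * sqrt (2 * pi * \<tau>1 * (b * real n)))) = E * sqrt (real n)"
        unfolding E_def by (simp add: real_sqrt_mult)
      also have "ennreal (1 / s) * ennreal (E * sqrt (real n)) = ennreal (E / (L * sqrt a))"
        using s E n by (simp add: ennreal_mult[symmetric] s_def real_sqrt_mult)
      finally have A_le: "emeasure (PW n) A \<le> ennreal (E / (L * sqrt a))"
        by (simp add: mult_left_mono)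
      \<comment> \<open>Outside \<open>A\<close> the tail bound is deterministic and below
        \<open>\<epsilon>\<close>. The posterior event enters only through this inclusion, so that
        measurability of \<open>A\<close> is enough.\<close>
      have sub: "{z \<in> space (PW n). \<epsilon> < post n z} \<subseteq> A"
      proof
        fix z assume z: "z \<in> {z \<in> space (PW n). \<epsilon> < post n z}"
        show "z \<in> A"
        proof (rule ccontr)
          assume "z \<notin> A"
          then have "ennreal (1 / s) * ennreal (score_bound X n \<theta>0 w l z) < 1"
            using z unfolding A_def by simp
          then have score: "score_bound X n \<theta>0 w l z \<le> s"
          proof (cases "0 \<le> score_bound X n \<theta>0 w l z")
            case True
            with \<open>_ < 1\<close> show ?thesis
              using s by (simp add: ennreal_mult[symmetric] ennreal_less_one_iff divide_less_eq)
          qed (use s in simp)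
          have "post n z \<le> G * exp (- c / 4 * (M n)\<^sup>2)"
            unfolding post_def G_def c_def
          proof (rule measure_whittle_posterior_le[OF P_prob P_density(1,2,3) P_bound(2)])
            show "\<gamma> \<le> g \<theta>" if "\<theta> \<in> ball \<theta>0 (1 / sqrt (real n))" for \<theta>
              using that \<rho>(2)[of \<theta>] elim(4) by (simp add: dist_commute)
            show "score_bound X n \<theta>0 (1 / (2 * pi * \<tau>0)) (\<tau>1 / \<tau>0\<^sup>2) z \<le> L * sqrt (a * real n)"
              using score unfolding s_def w_def l_def .
            show "2 * L / (1 / (4 * pi * \<tau>1)) \<le> M n" using elim(3) unfolding c_def .
          qed (use elim(1) Pf_finite Pf_sets n a b tau(1) \<open>0 < \<tau>1\<close> \<gamma> P_bound(1) L M(1) in \<open>auto intro: less_imp_le\<close>)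
          then show False using z elim(2) by simp
        qed
      qed
      have "emeasure (PW n) {z \<in> space (PW n). \<epsilon> < post n z} \<le> ennreal (E / (L * sqrt a))"
        using emeasure_mono[OF sub A_sets] A_le by (rule order_trans)
      then have "measure (PW n) {z \<in> space (PW n). \<epsilon> < post n z} \<le> E / (L * sqrt a)"
        unfolding measure_def using E L a by (intro enn2real_leI) auto
      also have "E / (L * sqrt a) < \<eta>"
      proof -
        have "\<eta> * sqrt a * L = 2 * E + \<eta> * sqrt a"
          unfolding L_def using \<eta> a by (simp add: field_simps)
        moreover have "0 < \<eta> * sqrt a" using \<eta> a by simp
        ultimately have "E < \<eta> * (L * sqrt a)" using E by (simp add: mult_ac)
        then show ?thesis using L a by (simp add: divide_less_eq)
      qed
      finally show ?case by simp
    qed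
  qed
qed

end
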